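(* Let $k\ge4$ be an even integer and let $a,b$ be positive integers with $\gcd(a,b)=1$. Let $\{h_i: 1\le i\le \lambda_{k+4}(ab)\}$ be a basis of $M_{k+4}(ab)$, where $\lambda_{k+4}(ab)=\dim M_{k+4}(ab)$, and let $c_i(n)$ denote the $n$-th Fourier coefficient of $h_i$. Then there exist constants $\gamma_i$, $1\le i\le\lambda_{k+4}(ab)$, such that for all integers $n\ge2$ $$\sum_{\substack{l,m\in\mathbb{N}\\ al+bm=n}} l\,\sigma(l)\sigma_{k-1}(m) = \frac{6n^2-a(k+1)n}{12a^2(k+1)(k+2)}\sigma_{k-1}(n/b) + \frac{B_k}{2a(k+2)}\,n\,\sigma(n/a) + \frac{2n}{a(k+2)}W^{1,k-1}_{a,b}(n) + \frac{B_k}{4a^2k(k+1)(k+2)}\sum_{i=1}^{\lambda_{k+4}(ab)}\gamma_i c_i(n),$$ where $B_k$ is the $k$-th Bernoulli number.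
   Context: For $r\in\mathbb{N}$ and a positive integer $n$, $\sigma_r(n)=\sum_{d\mid n,\,d\in\mathbb{N}}d^r$, $\sigma(n)=\sigma_1(n)$, and $\sigma_r(x)=0$ if $x$ is not a positive integer. $W^{1,k-1}_{a,b}(n)=\sum_{l,m\in\mathbb{N},\ al+bm=n}\sigma(l)\sigma_{k-1}(m)$. $M_k(N)$ is the space of holomorphic modular forms of weight $k$ on $\Gamma_0(N)$ with trivial character; Fourier expansions are in $q=e^{2\pi i z}$. Bernoulli numbers are normalized so that $E_k(z)=1-\frac{2k}{B_k}\sum_{n\ge1}\sigma_{k-1}(n)q^n$ is the normalized weight $k$ Eisenstein series for $SL_2(\mathbb{Z})$ (e.g. $B_4=-1/30$). *)

theory Defs
  imports "HOL-Complex_Analysis.Complex_Analysis"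
    "HOL-Computational_Algebra.Formal_Power_Series"
    "HOL-Library.Function_Algebras"
begin

definition bernoulli_number :: "nat \<Rightarrow> real" where
  "bernoulli_number n = fact n * fps_nth (fps_X / (fps_exp 1 - 1)) n"

text \<open>A check of the normalisation.\<close>

lemma bernoulli_number_4: "bernoulli_number 4 = - 1 / 30"
proof -
  define B :: "real fps" where "B = fps_X / (fps_exp 1 - 1)"
  have nz: "(fps_exp 1 - 1 :: real fps) $ 1 \<noteq> 0"
    by simp
  have "subdegree (fps_exp 1 - 1 :: real fps) = 1"
    by (rule subdegreeI) auto
  then have "(fps_exp 1 - 1 :: real fps) dvd fps_X"
    using nz by (subst fps_dvd_iff) auto
  then have B: "B * (fps_exp 1 - 1) = fps_X"
    unfolding B_def by simp
  have c: "(\<Sum>i=0..n. B $ i * (fps_exp 1 - 1) $ (n - i)) = fps_X $ n" for n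
    using B by (simp add: fps_mult_nth flip: B)
  note s = fact_numeral numeral_eq_Suc
  from c[of 1] c[of 2] c[of 3] c[of 4] c[of 5] have "B $ 4 = - 1 / 720"
    by (simp add: s field_simps fact_Suc)
  then show ?thesis
    unfolding bernoulli_number_def B_def[symmetric] by (simp add: fact_numeral)
qed

text \<open>The argument is real so that expressions such as \<open>\<sigma>\<^sub>r(n/b)\<close> make sense;
  the value is \<open>0\<close> unless the argument is a positive integer.\<close>

definition divisor_sigma :: "nat \<Rightarrow> real \<Rightarrow> nat" where
  "divisor_sigma r x =
    (if x \<in> \<nat> \<and> x > 0 then \<Sum>d | d dvd nat \<lfloor>x\<rfloor>. d ^ r else 0)"

definition conv_pairs :: "nat \<Rightarrow> nat \<Rightarrow> nat \<Rightarrow> (nat \<times> nat) set" where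
  "conv_pairs a b n = {(l, m). l > 0 \<and> m > 0 \<and> a * l + b * m = n}"

definition conv_sum :: "nat \<Rightarrow> nat \<Rightarrow> nat \<Rightarrow> nat \<Rightarrow> nat \<Rightarrow> nat" where
  "conv_sum r s a b n =
    (\<Sum>(l, m) \<in> conv_pairs a b n. divisor_sigma r (real l) * divisor_sigma s (real m))"

definition upper_half_plane :: "complex set" where
  "upper_half_plane = {z. Im z > 0}"

definition SL2Z :: "(int ^ 2 ^ 2) set" where
  "SL2Z = {A. det A = 1}"

definition Gamma0 :: "nat \<Rightarrow> (int ^ 2 ^ 2) set" where
  "Gamma0 N = {A \<in> SL2Z. int N dvd A $ 2 $ 1}"

definition slash :: "nat \<Rightarrow> int ^ 2 ^ 2 \<Rightarrow> (complex \<Rightarrow> complex) \<Rightarrow> complex \<Rightarrow> complex" where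
  "slash k A f z =
    f ((of_int (A $ 1 $ 1) * z + of_int (A $ 1 $ 2)) / (of_int (A $ 2 $ 1) * z + of_int (A $ 2 $ 2)))
      / (of_int (A $ 2 $ 1) * z + of_int (A $ 2 $ 2)) ^ k"

text \<open>With period \<open>h\<close>, the function is a holomorphic function of the local coordinate
  \<open>exp (2 \<pi> i z / h)\<close>, including at the point \<open>0\<close> corresponding to the cusp.\<close>

definition holomorphic_at_i_infinity :: "(complex \<Rightarrow> complex) \<Rightarrow> bool" where
  "holomorphic_at_i_infinity f \<longleftrightarrow>
    (\<exists>h::nat. h > 0 \<and> (\<exists>F. F holomorphic_on ball 0 1 \<and>
      (\<forall>z\<in>upper_half_plane. f z = F (exp (2 * of_real pi * \<i> * z / of_nat h)))))"

text \<open>Modular forms are functions on the upper half plane. They are represented as total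
  functions that vanish off the half plane, so that distinct elements of the set are distinct
  modular forms and linear algebra over the set is the intended one.\<close>

definition modular_forms :: "nat \<Rightarrow> nat \<Rightarrow> (complex \<Rightarrow> complex) set" where
  "modular_forms k N =
    {f. f holomorphic_on upper_half_plane \<and>
        (\<forall>z. z \<notin> upper_half_plane \<longrightarrow> f z = 0) \<and>
        (\<forall>A\<in>Gamma0 N. \<forall>z\<in>upper_half_plane. slash k A f z = f z) \<and>
        (\<forall>A\<in>SL2Z. holomorphic_at_i_infinity (slash k A f))}"

definition fourier_coeff :: "(complex \<Rightarrow> complex) \<Rightarrow> nat \<Rightarrow> complex" where
  "fourier_coeff f =
    (THE c. \<forall>z\<in>upper_half_plane. (\<lambda>n. c n * exp (2 * of_real pi * \<i> * z) ^ n) sums f z)"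

global_interpretation cfun: vector_space "\<lambda>(c::complex) (f::complex \<Rightarrow> complex) z. c * f z"
  by unfold_locales (auto simp: fun_eq_iff algebra_simps)

definition indexed_basis ::
  "'i set \<Rightarrow> ('i \<Rightarrow> complex \<Rightarrow> complex) \<Rightarrow> (complex \<Rightarrow> complex) set \<Rightarrow> bool" where
  "indexed_basis I h V \<longleftrightarrow>
    inj_on h I \<and> cfun.independent (h ` I) \<and> cfun.span (h ` I) = V"

lemma modular_forms_subspace: "cfun.subspace (modular_forms k N)"
proof (rule cfun.subspaceI)
  show "0 \<in> modular_forms k N"
    by (auto simp: modular_forms_def slash_def zero_fun_def holomorphic_at_i_infinity_def
        intro!: exI[of _ "1::nat"] exI[of _ "\<lambda>_. 0"])
next
  fix c f assume f: "f \<in> modular_forms k N"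
  have "holomorphic_at_i_infinity (slash k A (\<lambda>z. c * f z))" if A: "A \<in> SL2Z" for A
  proof -
    from f A obtain h F where "h > 0" "F holomorphic_on ball 0 1"
      "\<forall>z\<in>upper_half_plane. slash k A f z = F (exp (2 * of_real pi * \<i> * z / of_nat h))"
      unfolding modular_forms_def holomorphic_at_i_infinity_def by blast
    then show ?thesis
      unfolding holomorphic_at_i_infinity_def
      by (intro exI[of _ h] exI[of _ "\<lambda>w. c * F w"])
        (auto simp: slash_def simp flip: times_divide_eq_right intro!: holomorphic_intros)
  qed
  with f show "(\<lambda>z. c * f z) \<in> modular_forms k N"
    by (auto simp: modular_forms_def slash_def simp flip: times_divide_eq_right intro!: holomorphic_intros)
next
  fix f g assume f: "f \<in> modular_forms k N" and g: "g \<in> modular_forms k N"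
  have "holomorphic_at_i_infinity (slash k A (f + g))" if A: "A \<in> SL2Z" for A
  proof -
    from f A obtain h F where F: "h > 0" "F holomorphic_on ball 0 1"
      "\<forall>z\<in>upper_half_plane. slash k A f z = F (exp (2 * of_real pi * \<i> * z / of_nat h))"
      unfolding modular_forms_def holomorphic_at_i_infinity_def by blast
    from g A obtain h' G where G: "h' > 0" "G holomorphic_on ball 0 1"
      "\<forall>z\<in>upper_half_plane. slash k A g z = G (exp (2 * of_real pi * \<i> * z / of_nat h'))"
      unfolding modular_forms_def holomorphic_at_i_infinity_def by blast
    have pow: "(\<lambda>w. H (w ^ m)) holomorphic_on ball 0 1"
      if "H holomorphic_on ball 0 1" "m > 0" for H :: "complex \<Rightarrow> complex" and m
    proof -
      have "(\<lambda>w::complex. w ^ m) ` ball 0 1 \<subseteq> ball 0 1"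
        using \<open>m > 0\<close> by (auto simp: norm_power power_less_one_iff)
      then show ?thesis
        using holomorphic_on_compose_gen[of "\<lambda>w. w ^ m" "ball 0 1" H "ball 0 1"] that(1)
          holomorphic_on_power[OF holomorphic_on_ident]
        unfolding o_def by blast
    qed
    have "(\<lambda>w. F (w ^ h')) holomorphic_on ball 0 1" "(\<lambda>w. G (w ^ h)) holomorphic_on ball 0 1"
      using pow F G by blast+
    moreover have "exp (2 * of_real pi * \<i> * z / of_nat (h * h')) ^ h' = exp (2 * of_real pi * \<i> * z / of_nat h)"
      "exp (2 * of_real pi * \<i> * z / of_nat (h * h')) ^ h = exp (2 * of_real pi * \<i> * z / of_nat h')" for z
      using F(1) G(1) by (simp_all flip: exp_of_nat_mult)
    ultimately show ?thesis
      unfolding holomorphic_at_i_infinity_def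
      using F G
      by (intro exI[of _ "h * h'"] exI[of _ "\<lambda>w. F (w ^ h') + G (w ^ h)"])
        (auto simp: slash_def add_divide_distrib simp del: of_nat_mult intro!: holomorphic_intros)
  qed
  with f g show "f + g \<in> modular_forms k N"
    by (auto simp: modular_forms_def slash_def add_divide_distrib plus_fun_def intro!: holomorphic_intros)
qed

end

theory Submission
  imports Defs
begin

text \<open>
  Write \<open>G\<^sub>k = - B\<^sub>k / (2 k) + \<Sum> \<sigma>\<^sub>k\<^sub>-\<^sub>1(n) q\<^sup>n\<close>, \<open>f(z) = G\<^sub>2(a z)\<close> and \<open>g(z) = G\<^sub>k(b z)\<close>. The function \<open>f\<close> is quasimodular:
  under a substitution with lower row \<open>(c, d)\<close> it acquires the extra term \<open>s c (c z + d)\<close>, where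
  \<open>s = - 1 / (4 \<pi> i a)\<close>. The combination \<open>k f' g - 2 f g' + s / (k + 1) g''\<close>, which up to a factor is the second
  Rankin--Cohen bracket of \<open>\<Delta>(a z)\<close> and \<open>g\<close> divided by \<open>\<Delta>(a z)\<close>, cancels all the extra terms and lies
  in \<open>M\<^sub>k\<^sub>+\<^sub>4(a b)\<close>. Its \<open>n\<close>-th Fourier coefficient is a linear combination of the sum in question and
  the explicit terms, and expanding it in the given basis yields the constants \<open>\<gamma>\<^sub>i\<close>.

  The transformation laws of \<open>G\<^sub>k\<close> and \<open>G\<^sub>2\<close> come from sums over the lattice \<open>\<int> \<tau> + \<int>\<close>, evaluated row by
  row with the cotangent series. For weight 2 the absolutely convergent sum of
  \<open>1/w\<^sup>2 - 1/w + 1/(w + 1)\<close> is used: the rows of the original lattice telescope, while those of the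
  transformed lattice leave the quasimodular correction.
\<close>

section \<open>The nome and the cotangent series\<close>

text \<open>Why derivatives: \<open>f' g\<close> weights the products of coefficients by
  \<open>a l\<close> and \<open>f g'\<close> by \<open>b m\<close>, and \<open>a l + b m = n\<close>
  expresses the second weight through the first and \<open>W\<close>. Hence
  \<open>k f' g - 2 f g'\<close> contains \<open>a (k + 2)\<close> times the sum in question, which
  explains the denominators in the theorem. The constant terms of \<open>f\<close> and
  \<open>g\<close> (the first is -1/24) and the term \<open>g''\<close> produce the explicit divisor
  sums.

  Two obstacles shape the proof. Membership in the space of modular forms is a condition at every
  cusp, so the bracket has to be followed under all of SL2(Z), where \<open>f\<close> and
  \<open>g\<close> turn into other functions \<open>f1\<close> and \<open>g1\<close>; what makes
  this work is that the constant \<open>s\<close> stays the same. Moreover, the Bernoulli numbers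
  are given by a generating series, whereas the lattice sums produce zeta values; Euler's formula is
  the link. It also shows that B_k is nonzero, which is needed because the \<gamma>_i carry a
  prefactor B_k that must be divided out.\<close>

definition nome :: "complex \<Rightarrow> complex" where
  "nome z = exp (2 * of_real pi * \<i> * z)"

lemma norm_nome: "norm (nome z) = exp (- 2 * pi * Im z)"
  by (simp add: nome_def)

lemma norm_nome_less_1: "Im z > 0 \<Longrightarrow> norm (nome z) < 1"
  by (simp add: norm_nome)

lemma nome_add: "nome (z + w) = nome z * nome w"
  by (simp add: nome_def exp_add ring_distribs)

lemma nome_of_nat_mult: "nome (of_nat n * z) = nome z ^ n"
  by (simp add: nome_def flip: exp_of_nat_mult) (simp add: mult_ac)

text \<open>The operator 2 pi i q d/dq, that is d/dz acting on expansions in q.\<close>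

definition nome_deriv :: "complex fps \<Rightarrow> complex fps" where
  "nome_deriv F = fps_const (2 * of_real pi * \<i>) * fps_X * fps_deriv F"

lemma nome_deriv_nth: "nome_deriv F $ n = 2 * of_real pi * \<i> * of_nat n * F $ n"
  by (cases n) (simp_all add: nome_deriv_def mult.assoc fps_mult_left_const_nth)

lemma conv_radius_mult_ge:
  fixes F G :: "complex fps"
  assumes "fps_conv_radius F \<ge> r" "fps_conv_radius G \<ge> r"
  shows "fps_conv_radius (F * G) \<ge> r"
  using fps_conv_radius_mult[of F G] assms by (meson min.boundedI order_trans)

lemma conv_radius_nome_deriv:
  assumes "fps_conv_radius F \<ge> r"
  shows "fps_conv_radius (nome_deriv F) \<ge> r"
  unfolding nome_deriv_def
  using assms fps_conv_radius_deriv[of F] by (intro conv_radius_mult_ge) auto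

lemma less_conv_radiusI:
  fixes x :: complex
  assumes "fps_conv_radius F \<ge> 1" "norm x < 1"
  shows "norm x < fps_conv_radius F"
  using assms by (metis ereal_less(3) less_le_trans one_ereal_def)

lemma in_eball_nome:
  assumes "fps_conv_radius F \<ge> 1" "Im z > 0"
  shows "norm (nome z) < fps_conv_radius F"
  by (rule less_conv_radiusI[OF assms(1) norm_nome_less_1[OF assms(2)]])

lemma has_field_derivative_eval_fps_nome:
  assumes "fps_conv_radius F \<ge> 1" "Im z > 0"
  shows "((\<lambda>z. eval_fps F (nome z)) has_field_derivative eval_fps (nome_deriv F) (nome z)) (at z within A)"
proof -
  have F: "norm (nome z) < fps_conv_radius F"
    using in_eball_nome assms by blast
  have "((\<lambda>z. eval_fps F (nome z)) has_field_derivative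
      eval_fps (fps_deriv F) (nome z) * (2 * of_real pi * \<i> * nome z)) (at z within A)"
    by (rule DERIV_chain2[where f = "eval_fps F" and g = nome, OF has_field_derivative_eval_fps[OF F, of UNIV]])
      (auto simp: nome_def [abs_def] intro!: derivative_eq_intros)
  also have "eval_fps (fps_deriv F) (nome z) * (2 * of_real pi * \<i> * nome z) =
      eval_fps (nome_deriv F) (nome z)"
  proof -
    have "norm (nome z) < fps_conv_radius (fps_deriv F)"
      using F fps_conv_radius_deriv[of F] by (meson less_le_trans)
    moreover have "norm (nome z) < fps_conv_radius (fps_const (2 * of_real pi * \<i>) * fps_X :: complex fps)"
      by (rule less_le_trans[OF _ conv_radius_mult_ge[of \<infinity>]]) auto
    ultimately show ?thesis
      unfolding nome_deriv_def by (subst eval_fps_mult) (simp_all add: eval_fps_mult)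
  qed
  finally show ?thesis .
qed

text \<open>Differentiate the reflection formula for \<open>rGamma z * rGamma (1 - z)\<close> once
  by the product rule and once as a sine, then divide by the sine.\<close>

lemma Digamma_reflection:
  assumes "z \<notin> \<int>"
  shows "Digamma (1 - z) - Digamma z = of_real pi * cot (of_real pi * z :: complex)"
proof -
  have "1 - z \<notin> \<int>"
    using assms by (metis Ints_1 Ints_diff diff_diff_eq2 diff_add_cancel add.commute)
  then have nonpos: "z \<notin> \<int>\<^sub>\<le>\<^sub>0" "1 - z \<notin> \<int>\<^sub>\<le>\<^sub>0"
    using assms by (auto dest: nonpos_Ints_Int)
  have "((\<lambda>z. rGamma z * rGamma (1 - z :: complex)) has_field_derivative
      (- rGamma z * Digamma z * rGamma (1 - z) + rGamma z * (rGamma (1 - z) * Digamma (1 - z)))) (at z)"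
    using nonpos
    by (auto intro!: derivative_eq_intros simp: algebra_simps)
  moreover have "((\<lambda>z. rGamma z * rGamma (1 - z :: complex)) has_field_derivative
      cos (of_real pi * z)) (at z)"
    unfolding rGamma_reflection_complex by (auto intro!: derivative_eq_intros)
  ultimately have "- rGamma z * Digamma z * rGamma (1 - z) + rGamma z * (rGamma (1 - z) * Digamma (1 - z))
      = cos (of_real pi * z)"
    by (rule DERIV_unique)
  then have "(rGamma z * rGamma (1 - z)) * (Digamma (1 - z) - Digamma z) = cos (of_real pi * z)"
    by (simp add: algebra_simps)
  moreover have "sin (of_real pi * z) \<noteq> 0"
    using assms by (auto simp: sin_eq_0 Ints_def)
  ultimately show ?thesis
    unfolding rGamma_reflection_complex by (simp add: cot_def field_simps)
qed

lemma cot_pi_plus_int: "cot (of_real pi * (w + of_int n)) = cot (of_real pi * w :: complex)"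
proof -
  have step: "cot (of_real pi * (z + 1)) = cot (of_real pi * z)" for z :: complex
    by (simp add: cot_def ring_distribs sin_add cos_add)
  show ?thesis
  proof (induction n rule: int_induct[of _ 0])
    case (step1 i)
    then show ?case
      using step[of "w + of_int i"] by (simp add: add_ac)
  next
    case (step2 i)
    then show ?case
      using step[of "w + of_int (i - 1)"] by (simp add: add_ac)
  qed simp
qed

text \<open>
  Series over \<open>\<int>\<close> that converge only conditionally are summed over the intervals \<open>{- N..<N}\<close>, by pairing
  \<open>n\<close> with \<open>- 1 - n\<close>.
\<close>

lemma sum_int_halves:
  fixes f :: "int \<Rightarrow> 'a :: comm_monoid_add"
  shows "(\<Sum>n<N. f (int n) + f (- 1 - int n)) = sum f {- int N..<int N}"
proof (induction N)
  case (Suc N)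
  have "{- int (Suc N)..<int (Suc N)} = insert (int N) (insert (- 1 - int N) {- int N..<int N})"
    by auto
  then show ?case
    using Suc by (simp add: add_ac)
qed simp

lemma has_sum_int_imp_sums:
  assumes "(f has_sum S) (UNIV :: int set)"
  shows "(\<lambda>n. f (int n) + f (- 1 - int n)) sums S"
  unfolding sums_def sum_int_halves
proof (rule filterlim_compose[OF assms[unfolded has_sum_def]])
  show "filterlim (\<lambda>N. {- int N..<int N}) (finite_subsets_at_top UNIV) sequentially"
    unfolding filterlim_finite_subsets_at_top
  proof safe
    fix X :: "int set" assume "finite X"
    then have K: "\<bar>x\<bar> \<le> Max (abs ` X)" if "x \<in> X" for x
      using that by simp
    define K where "K = Max (abs ` X)"
    note K = K[folded K_def]
    show "\<forall>\<^sub>F N in sequentially. finite {- int N..<int N} \<and> X \<subseteq> {- int N..<int N} \<and> {- int N..<int N} \<subseteq> UNIV"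
      using eventually_gt_at_top[of "nat K"]
      by eventually_elim (use K in fastforce)
  qed
qed

text \<open>A shift by 1 telescopes to the difference of the limits at the two ends; a shift by
  \<open>c\<close> is composed of \<open>c\<close> unit shifts, whence the induction in both
  directions. With vanishing limits it shows that a shift does not change the sum; with the limits
  of the cotangent it produces the weight 2 correction.\<close>

lemma sums_int_shift:
  fixes f :: "int \<Rightarrow> complex"
  assumes A: "(\<lambda>n. f (int n)) \<longlonglongrightarrow> A" and B: "(\<lambda>n. f (- int n)) \<longlonglongrightarrow> B"
  shows "(\<lambda>n. (f (int n) - f (int n - c)) + (f (- 1 - int n) - f (- 1 - int n - c)))
    sums (of_int c * (A - B))"
proof -
  \<comment> \<open>Starting the sequence at \<bar>c\<bar> keeps all arguments nonnegative, so that
    only values governed by the limit \<open>A\<close> occur.\<close>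
  have A': "(\<lambda>n. f (int n + c)) \<longlonglongrightarrow> A" for c
  proof -
    have "(\<lambda>n. f (int (n + nat c))) \<longlonglongrightarrow> A"
      using A by (rule LIMSEQ_ignore_initial_segment)
    moreover have "(\<lambda>n. f (int (n + nat \<bar>c\<bar>) + c)) = (\<lambda>n. f (int (n + nat c + nat c)))"  if "c \<ge> 0"
      using that by (simp add: algebra_simps)
    moreover have "(\<lambda>n. f (int (n + nat \<bar>c\<bar>) + c)) = (\<lambda>n. f (int n))" if "c < 0"
      using that by (simp add: algebra_simps)
    ultimately have "(\<lambda>n. f (int (n + nat \<bar>c\<bar>) + c)) \<longlonglongrightarrow> A"
      using A LIMSEQ_ignore_initial_segment[OF A, of "nat c + nat c"]
      by (cases "c \<ge> 0") (auto simp: add.assoc)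
    then show ?thesis
      by (rule LIMSEQ_offset)
  qed
  have B': "(\<lambda>n. f (- int n - c)) \<longlonglongrightarrow> B" for c
  proof -
    have "(\<lambda>n. f (- int (n + nat \<bar>c\<bar>) - c)) \<longlonglongrightarrow> B"
    proof (cases "c \<ge> 0")
      case True
      then have "(\<lambda>n. f (- int (n + nat \<bar>c\<bar>) - c)) = (\<lambda>n. f (- int (n + (nat c + nat c))))"
        by (simp add: algebra_simps)
      then show ?thesis
        using LIMSEQ_ignore_initial_segment[OF B, of "nat c + nat c"] by (simp only:)
    qed (use B in \<open>simp add: algebra_simps\<close>)
    then show ?thesis
      by (rule LIMSEQ_offset)
  qed
  have step: "(\<lambda>n. (f (int n - c) - f (int n - (c + 1))) + (f (- 1 - int n - c) - f (- 1 - int n - (c + 1))))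
      sums (A - B)" for c
  proof -
    have "(\<Sum>n<N. (f (int n - c) - f (int n - (c + 1))) + (f (- 1 - int n - c) - f (- 1 - int n - (c + 1))))
        = f (int N + (- 1 - c)) - f (- int N - (c + 1))" for N
    proof (induction N)
      case (Suc N)
      have "int (Suc N) + (- 1 - c) = int N - c" "int N + (- 1 - c) = int N - (c + 1)"
        "- int (Suc N) - (c + 1) = - 1 - int N - (c + 1)" "- int N - (c + 1) = - 1 - int N - c"
        by simp_all
      with Suc show ?case
        by (simp only: sum.lessThan_Suc) simp
    qed (simp add: algebra_simps)
    then show ?thesis
      unfolding sums_def using tendsto_diff[OF A'[of "-1-c"] B'[of "c+1"]] by simp
  qed
  show ?thesis
  proof (induction c rule: int_induct[of _ 0])
    case base
    then show ?case by simp
  next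
    case (step1 i)
    from sums_add[OF step1(2) step[of i]] show ?case
      by (simp add: algebra_simps)
  next
    case (step2 i)
    from sums_diff[OF step2(2) step[of "i-1"]] show ?case
      by (simp add: algebra_simps)
  qed
qed

text \<open>
  For integral \<open>w\<close> both sides are \<open>0\<close>: the term \<open>1/0 = 0\<close> drops out of the sum, and \<open>cot\<close> has the value \<open>0\<close> at its poles.
\<close>

lemma sums_cot:
  "(\<lambda>n. inverse (w + of_int (int n)) + inverse (w + of_int (- 1 - int n))) sums
    (of_real pi * cot (of_real pi * w :: complex))"
proof (cases "w \<in> \<int>")
  case False
  have "w \<noteq> 0" "1 - w \<noteq> 0"
    using False by auto
  \<comment> \<open>The logarithms in the two limits cancel, and the partial sums at
    \<open>w\<close> and \<open>1 - w\<close> are the two halves of the series.\<close>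
  from tendsto_diff[OF Digamma_LIMSEQ[OF this(2)] Digamma_LIMSEQ[OF this(1)]]
  have "(\<lambda>m. (\<Sum>n<m. inverse (w + of_nat n)) - (\<Sum>n<m. inverse (1 - w + of_nat n)))
      \<longlonglongrightarrow> of_real pi * cot (of_real pi * w)"
    by (simp add: Digamma_reflection[OF False])
  moreover have "inverse (w + of_int (- 1 - int n)) = - inverse (1 - w + of_nat n)" for n
    by (subst inverse_minus_eq[symmetric]) (simp add: algebra_simps)
  ultimately show ?thesis
    unfolding sums_def by (simp add: sum_subtractf)
next
  case True
  then obtain c where w: "w = of_int c"
    by (auto elim: Ints_cases)
  have lim: "(\<lambda>n. inverse (of_int (int n)) :: complex) \<longlonglongrightarrow> 0" "(\<lambda>n. inverse (of_int (- int n)) :: complex) \<longlonglongrightarrow> 0"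
    using lim_inverse_n[where 'a = complex] tendsto_minus[OF lim_inverse_n[where 'a = complex]]
    by (simp_all add: field_simps)
  \<comment> \<open>The pairs are 1/n - 1/(n + 1); the total is 0 because the first term of the
    telescope is 1/0 = 0.\<close>
  have *: "(\<lambda>n. inverse (of_int (int n)) + inverse (of_int (- 1 - int n)) :: complex) sums 0"
  proof -
    have "(\<lambda>n. inverse (of_int (int (Suc n))) - inverse (of_int (int n)) :: complex) sums (0 - inverse (of_int (int 0)))"
      by (rule telescope_sums[OF lim(1)])
    then have "(\<lambda>n. - (inverse (of_int (int (Suc n))) - inverse (of_int (int n))) :: complex) sums 0"
      using sums_minus by fastforce
    moreover have "inverse (of_int (- 1 - int n)) = - inverse (of_int (int (Suc n)) :: complex)" for n
      by (subst inverse_minus_eq[symmetric]) (simp add: algebra_simps)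
    ultimately show ?thesis by simp
  qed
  \<comment> \<open>Passing from base point 0 to the integer \<open>c\<close> costs a multiple of
    the difference of the limits of 1/n, both of which are 0.\<close>
  have "(\<lambda>n. (inverse (of_int (int n)) + inverse (of_int (- 1 - int n)) :: complex) -
     ((inverse (of_int (int n)) - inverse (of_int (int n + c))) + (inverse (of_int (- 1 - int n)) - inverse (of_int (- 1 - int n + c))))) sums (0 - of_int (- c) * (0 - 0))"
    using sums_diff[OF * sums_int_shift[OF lim, of "-c"]] by simp
  moreover have "cot (of_real pi * w) = 0"
    using cot_pi_plus_int[of 0 c] by (simp add: w cot_def)
  ultimately show ?thesis
    by (simp add: w algebra_simps)
qed

lemma sums_cot_shift:
  "(\<lambda>n. inverse (w + of_int (int n) + of_int c) + inverse (w + of_int (- 1 - int n) + of_int c)) sums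
    (of_real pi * cot (of_real pi * w :: complex))"
  using sums_cot[of "w + of_int c"] by (simp only: cot_pi_plus_int add_ac)

lemma cot_nome:
  assumes "nome w \<noteq> 1"
  shows "of_real pi * cot (of_real pi * w) = - of_real pi * \<i> * (1 + nome w) / (1 - nome w)"
proof -
  define y where "y = exp (\<i> * (of_real pi * w))"
  have y: "nome w = y * y" "exp (-(\<i> * (of_real pi * w))) = inverse y" "y \<noteq> 0"
    by (simp_all add: y_def nome_def exp_minus flip: exp_add) (simp add: algebra_simps)
  have "y * y \<noteq> 1"
    using assms y(1) by simp
  moreover have "sin (of_real pi * w) = (y - inverse y) / (2 * \<i>)" "cos (of_real pi * w) = (y + inverse y) / 2"
    unfolding sin_exp_eq cos_exp_eq y(2) y_def by simp_all
  ultimately have "cot (of_real pi * w) = ((y + inverse y) / 2) / ((y - inverse y) / (2 * \<i>))"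
    by (simp only: cot_def)
  also have "\<dots> = - \<i> * (1 + y * y) / (1 - y * y)"
    using \<open>y \<noteq> 0\<close> \<open>y * y \<noteq> 1\<close> by (simp add: divide_simps) (simp add: algebra_simps)
  finally show ?thesis
    by (simp add: y(1))
qed

section \<open>Sums over one row of the lattice\<close>

text \<open>At \<open>w = 0\<close> the term \<open>1/0 = 0\<close> drops out, so that \<open>int_row k 0 = 2 \<zeta>(k)\<close> for even \<open>k\<close>.\<close>

definition int_row :: "nat \<Rightarrow> complex \<Rightarrow> complex" where
  "int_row k w = (\<Sum>n. inverse ((w + of_int (int n)) ^ k) + inverse ((w + of_int (- 1 - int n)) ^ k))"

text \<open>Each half of the row is a polygamma series: evenness of \<open>k\<close> turns the
  negative half, with base \<open>w - 1 - n\<close>, into the series at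
  \<open>1 - w\<close>.\<close>

lemma int_row_nonint:
  fixes w :: complex
  assumes "even k" "k \<ge> 2" "w \<notin> \<int>"
  shows "(\<lambda>n. inverse ((w + of_int (int n)) ^ k) + inverse ((w + of_int (- 1 - int n)) ^ k))
    sums ((Polygamma (k - 1) w + Polygamma (k - 1) (1 - w)) / fact (k - 1))"
proof -
  have k: "Suc (k - 1) = k" "k - 1 > 0"
    using assms by auto
  have z: "w \<noteq> 0" "1 - w \<noteq> 0"
    using assms by auto
  have "(\<lambda>n. inverse ((z + of_nat n) ^ k)) sums (Polygamma (k - 1) z / fact (k - 1))"
    if "z \<noteq> 0" for z :: complex
    using Polygamma_LIMSEQ[OF that k(2), unfolded k(1)] \<open>even k\<close> by simp
  from sums_add[OF this[OF z(1)] this[OF z(2)]]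
  have "(\<lambda>n. inverse ((w + of_nat n) ^ k) + inverse ((1 - w + of_nat n) ^ k))
    sums ((Polygamma (k - 1) w + Polygamma (k - 1) (1 - w)) / fact (k - 1))"
    by (simp add: add_divide_distrib)
  moreover have "(w + of_int (- 1 - int n)) ^ k = (1 - w + of_nat n) ^ k" for n
    using power_minus_even[OF \<open>even k\<close>, of "1 - w + of_nat n"] by (simp add: algebra_simps)
  ultimately show ?thesis
    by simp
qed

lemma int_row_zero:
  assumes "even k" "k \<ge> 2"
  shows "(\<lambda>n. inverse ((0 + of_int (int n)) ^ k) + inverse ((0 + of_int (- 1 - int n)) ^ k))
    sums (2 * Polygamma (k - 1) 1 / fact (k - 1) :: complex)"
proof -
  have k: "Suc (k - 1) = k" "k - 1 > 0"
    using assms by auto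
  have *: "(\<lambda>n. inverse ((1 + of_nat n) ^ k)) sums (Polygamma (k - 1) 1 / fact (k - 1) :: complex)"
    using Polygamma_LIMSEQ[of "1::complex", OF _ k(2), unfolded k(1)] \<open>even k\<close> by simp
  then have "(\<lambda>n. inverse (of_nat (Suc n) ^ k)) sums (Polygamma (k - 1) 1 / fact (k - 1) :: complex)"
    by simp
  then have "(\<lambda>n. inverse (of_nat n ^ k)) sums
      (Polygamma (k - 1) 1 / fact (k - 1) + inverse (of_nat 0 ^ k) :: complex)"
    by (subst (asm) sums_Suc_iff) simp
  from sums_add[OF this *]
  have "(\<lambda>n. inverse (of_nat n ^ k) + inverse ((1 + of_nat n) ^ k))
    sums (2 * Polygamma (k - 1) 1 / fact (k - 1) :: complex)"
    using assms by (simp add: power_0_left)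
  moreover have "(0 + of_int (- 1 - int n) :: complex) ^ k = (1 + of_nat n) ^ k" for n
    using power_minus_even[OF \<open>even k\<close>, of "1 + of_nat n :: complex"] by (simp add: algebra_simps)
  ultimately show ?thesis
    by simp
qed

lemma sums_int_row:
  assumes "even k" "k \<ge> 2" "w \<notin> \<int> \<or> w = 0"
  shows "(\<lambda>n. inverse ((w + of_int (int n)) ^ k) + inverse ((w + of_int (- 1 - int n)) ^ k))
    sums int_row k w"
  unfolding int_row_def
  by (rule summable_sums) (use assms(3) int_row_zero[OF assms(1,2)] int_row_nonint[OF assms(1,2), of w] in \<open>auto dest: sums_summable\<close>)

lemma int_row_eq_Polygamma:
  "even k \<Longrightarrow> k \<ge> 2 \<Longrightarrow> w \<notin> \<int> \<Longrightarrow>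
    int_row k w = (Polygamma (k - 1) w + Polygamma (k - 1) (1 - w)) / fact (k - 1)"
  using int_row_nonint[of k w] by (simp add: int_row_def sums_iff)

lemma int_row_0_eq:
  "even k \<Longrightarrow> k \<ge> 2 \<Longrightarrow> int_row k 0 = 2 * Polygamma (k - 1) 1 / fact (k - 1)"
  using int_row_zero[of k] by (simp add: int_row_def sums_iff)

text \<open>The intervals of summation are not symmetric, so a sign change of the index is not
  enough. The recurrences for \<open>Polygamma\<close> at \<open>w\<close> and at \<open>- w\<close>
  produce the same term \<open>fact (k - 1) / w ^ k\<close>, which cancels.\<close>

lemma int_row_minus:
  assumes "even k" "k \<ge> 2" "w \<notin> \<int>"
  shows "int_row k (- w) = int_row k w"
proof -
  have w: "- w \<notin> \<int>" "1 + w \<notin> \<int>"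
    using assms(3) Ints_diff[of "1 + w" 1] by (auto simp: minus_in_Ints_iff)
  have "w \<noteq> 0"
    using assms(3) by auto
  have 1: "Polygamma (k - 1) (1 + w) = Polygamma (k - 1) w - fact (k - 1) / w ^ k"
    using Polygamma_plus1[OF \<open>w \<noteq> 0\<close>, of "k - 1"] assms by (simp add: add.commute field_simps del: power_Suc)
  have 2: "Polygamma (k - 1) (1 - w) = Polygamma (k - 1) (- w) - fact (k - 1) / w ^ k"
    using Polygamma_plus1[of "- w" "k - 1"] assms \<open>w \<noteq> 0\<close> by (simp add: field_simps del: power_Suc)
  have "Polygamma (k - 1) (- w) + Polygamma (k - 1) (1 - - w) = Polygamma (k - 1) w + Polygamma (k - 1) (1 - w)"
    unfolding 2 minus_minus diff_minus_eq_add 1 by simp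
  then show ?thesis
    by (subst (1 2) int_row_eq_Polygamma) (use assms w in simp_all)
qed

text \<open>The q-expansion of the j-th derivative of pi cot(pi w) in the upper half plane. For
  \<open>j = 0\<close> it is - pi i - 2 pi i (q + q^2 + ...).\<close>

definition cot_fps :: "nat \<Rightarrow> complex fps" where
  "cot_fps j = Abs_fps (\<lambda>n. if n = 0 then (if j = 0 then - of_real pi * \<i> else 0)
     else - 2 * of_real pi * \<i> * (2 * of_real pi * \<i> * of_nat n) ^ j)"

lemma cot_fps_Suc: "cot_fps (Suc j) = nome_deriv (cot_fps j)"
  by (rule fps_ext) (simp add: nome_deriv_nth cot_fps_def)

lemma sums_cot_fps_0:
  assumes "norm (x::complex) < 1"
  shows "(\<lambda>n. fps_nth (cot_fps 0) n * x ^ n) sums (- of_real pi * \<i> * (1 + x) / (1 - x))"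
proof -
  have x: "1 - x \<noteq> 0"
    using assms by auto
  have "(\<lambda>n. - 2 * of_real pi * \<i> * x ^ n + (if n = 0 then of_real pi * \<i> else 0)) sums
      (- 2 * of_real pi * \<i> * (1 / (1 - x)) + of_real pi * \<i>)"
    by (intro sums_add sums_mult geometric_sums assms sums_single[of 0 "\<lambda>_. of_real pi * \<i>", simplified])
  also have "(\<lambda>n. - 2 * of_real pi * \<i> * x ^ n + (if n = 0 then of_real pi * \<i> else 0)) =
      (\<lambda>n. fps_nth (cot_fps 0) n * x ^ n)"
    by (auto simp: cot_fps_def fun_eq_iff)
  also have "- 2 * of_real pi * \<i> * (1 / (1 - x)) + of_real pi * \<i> = - of_real pi * \<i> * (1 + x) / (1 - x)"
    using x by (simp add: field_simps)
  finally show ?thesis .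
qed

lemma fps_conv_radius_ge_1I:
  fixes F :: "complex fps"
  assumes "\<And>x::complex. norm x < 1 \<Longrightarrow> summable (\<lambda>n. fps_nth F n * x ^ n)"
  shows "fps_conv_radius F \<ge> 1"
  unfolding fps_conv_radius_def
proof (rule conv_radius_geI_ex)
  fix r :: real assume "0 < r" "ereal r < 1"
  then show "\<exists>z. norm z = r \<and> summable (\<lambda>n. F $ n * z ^ n)"
    using assms by (intro exI[of _ "of_real r"]) (auto simp: one_ereal_def)
qed

lemma conv_radius_cot_fps: "fps_conv_radius (cot_fps j) \<ge> 1"
proof (induction j)
  case 0
  show ?case
    by (rule fps_conv_radius_ge_1I) (use sums_cot_fps_0 sums_summable in blast)
qed (simp add: cot_fps_Suc conv_radius_nome_deriv)

lemma Im_pos_not_Ints: "Im w > 0 \<Longrightarrow> w \<notin> \<int>"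
  by (auto elim!: Ints_cases)

text \<open>The reflection formula for \<open>Digamma\<close> differentiated \<open>j\<close> times
  on the open half plane; the sign comes from the inner function \<open>1 - w\<close>.\<close>

lemma Polygamma_reflection_nome:
  assumes "Im w > 0"
  shows "(- 1) ^ j * Polygamma j (1 - w) - Polygamma j w = eval_fps (cot_fps j) (nome w)"
  using assms
proof (induction j arbitrary: w)
  case 0
  have ne: "nome w \<noteq> 1"
    using norm_nome_less_1[OF 0] by auto
  have "of_real pi * cot (of_real pi * w) = eval_fps (cot_fps 0) (nome w)"
    unfolding cot_nome[OF ne] eval_fps_def
    using sums_cot_fps_0[OF norm_nome_less_1[OF 0]] by (simp add: sums_iff)
  then show ?case
    using Digamma_reflection[of w] Im_pos_not_Ints[OF 0] by simp
next
  case (Suc j)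
  have nonpos: "w \<notin> \<int>\<^sub>\<le>\<^sub>0" "1 - w \<notin> \<int>\<^sub>\<le>\<^sub>0"
    using Suc.prems by (auto elim!: nonpos_Ints_cases simp: complex_eq_iff)
  have "((\<lambda>w. (- 1) ^ j * Polygamma j (1 - w) - Polygamma j w) has_field_derivative
      (- 1) ^ Suc j * Polygamma (Suc j) (1 - w) - Polygamma (Suc j) w) (at w)"
    using nonpos by (auto intro!: derivative_eq_intros)
  moreover have "((\<lambda>w. (- 1) ^ j * Polygamma j (1 - w) - Polygamma j w) has_field_derivative
      eval_fps (cot_fps (Suc j)) (nome w)) (at w)"
    unfolding cot_fps_Suc
  proof (rule DERIV_cong_ev[THEN iffD2, OF refl _ refl])
    show "((\<lambda>w. eval_fps (cot_fps j) (nome w)) has_field_derivative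
        eval_fps (nome_deriv (cot_fps j)) (nome w)) (at w)"
      using has_field_derivative_eval_fps_nome conv_radius_cot_fps Suc.prems by blast
    have "\<forall>\<^sub>F w in nhds w. w \<in> {w. Im w > 0}"
      using Suc.prems by (intro eventually_nhds_in_open open_halfspace_Im_gt) auto
    then show "\<forall>\<^sub>F w in nhds w. (- 1) ^ j * Polygamma j (1 - w) - Polygamma j w = eval_fps (cot_fps j) (nome w)"
      by eventually_elim (use Suc.IH in auto)
  qed
  ultimately show ?case
    by (rule DERIV_unique)
qed

text \<open>Lipschitz's formula. As \<open>k - 1\<close> is odd, the reflection formula involves
  exactly minus the sum of the two polygamma values that make up the row.\<close>

lemma int_row_nome:
  assumes "even k" "k \<ge> 2" "Im w > 0"
  shows "int_row k w = - eval_fps (cot_fps (k - 1)) (nome w) / fact (k - 1)"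
proof -
  have "odd (k - 1)"
    using assms by auto
  then show ?thesis
    using Polygamma_reflection_nome[OF assms(3), of "k - 1"] Im_pos_not_Ints[OF assms(3)]
    by (simp add: int_row_eq_Polygamma assms flip: Polygamma_reflection_nome)
qed

section \<open>Bernoulli numbers and Euler's formula for the zeta values at even integers\<close>

lemma bernoulli_fps_complex:
  fixes B :: "complex fps"
  defines "B \<equiv> Abs_fps (\<lambda>n. of_real (bernoulli_number n) / fact n)"
  shows "B * (fps_exp 1 - 1) = fps_X"
proof -
  define R where "R = (fps_X / (fps_exp 1 - 1) :: real fps)"
  have "subdegree (fps_exp 1 - 1 :: real fps) = 1"
    by (rule subdegreeI) auto
  then have "(fps_exp 1 - 1 :: real fps) dvd fps_X"
    by (subst fps_dvd_iff) auto
  then have R: "R * (fps_exp 1 - 1) = fps_X"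
    unfolding R_def by simp
  show ?thesis
  proof (rule fps_ext)
    fix n
    have "(B * (fps_exp 1 - 1)) $ n = (\<Sum>i=0..n. of_real (R $ i) * of_real ((fps_exp 1 - 1) $ (n - i)))"
      unfolding fps_mult_nth
      by (intro sum.cong refl) (simp add: B_def bernoulli_number_def R_def)
    also have "\<dots> = of_real ((R * (fps_exp 1 - 1)) $ n)"
      by (simp add: fps_mult_nth)
    finally show "(B * (fps_exp 1 - 1)) $ n = fps_X $ n"
      unfolding R by simp
  qed
qed

text \<open>
  The Taylor coefficients of \<open>1/w - \<pi> cot (\<pi> w)\<close> at \<open>0\<close> are computed twice: as values of polygamma
  functions, and from \<open>2 \<pi> i w / (exp (2 \<pi> i w) - 1)\<close>.
\<close>

lemma int_row_0_bernoulli: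
  assumes "even k" "k \<ge> 2"
  shows "int_row k 0 = - ((2 * of_real pi * \<i>) ^ k * of_real (bernoulli_number k) / fact k)"
proof -
  define c where "c = (2 * of_real pi * \<i> :: complex)"
  \<comment> \<open>Off 0 this is 1/w - pi cot(pi w), by the recurrence for \<open>Digamma\<close>;
    in this form it is visibly holomorphic at 0.\<close>
  define h :: "complex \<Rightarrow> complex" where "h = (\<lambda>w. Digamma (1 + w) - Digamma (1 - w))"
  have ball: "1 + w \<notin> \<int>\<^sub>\<le>\<^sub>0" "1 - w \<notin> \<int>\<^sub>\<le>\<^sub>0" if "w \<in> ball 0 1" for w :: complex
  proof -
    have "\<bar>Re w\<bar> < 1"
      using abs_Re_le_cmod[of w] that by simp
    then show "1 + w \<notin> \<int>\<^sub>\<le>\<^sub>0" "1 - w \<notin> \<int>\<^sub>\<le>\<^sub>0"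
      by (auto elim!: nonpos_Ints_cases simp: complex_eq_iff)
  qed
  have hol: "h holomorphic_on ball 0 1"
    unfolding h_def using ball 
    by (auto intro!: derivative_eq_intros simp: holomorphic_on_open)
  have higher: "(deriv ^^ j) h w = Polygamma j (1 + w) - (- 1) ^ j * Polygamma j (1 - w)"
    if "w \<in> ball 0 1" for j w
    using that
  proof (induction j arbitrary: w)
    case 0
    then show ?case by (simp add: h_def)
  next
    case (Suc j)
    have "\<forall>\<^sub>F x in nhds w. x \<in> ball 0 1"
      using Suc.prems by (intro eventually_nhds_in_open) auto
    then have "\<forall>\<^sub>F x in nhds w. (deriv ^^ j) h x = Polygamma j (1 + x) - (- 1) ^ j * Polygamma j (1 - x)"
      by eventually_elim (use Suc.IH in auto)
    then have "deriv ((deriv ^^ j) h) w = deriv (\<lambda>x. Polygamma j (1 + x) - (- 1) ^ j * Polygamma j (1 - x)) w"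
      by (rule deriv_cong_ev) simp
    also have "\<dots> = Polygamma (Suc j) (1 + w) - (- 1) ^ Suc j * Polygamma (Suc j) (1 - w)"
      using ball[OF Suc.prems] by (intro DERIV_imp_deriv) (auto intro!: derivative_eq_intros)
    finally show ?case
      by simp
  qed
  define H where "H = fps_expansion h 0"
  have H: "h has_fps_expansion H"
    unfolding H_def using hol by (intro has_fps_expansion_fps_expansion[of "ball 0 1"]) auto
  define B :: "complex fps" where "B = Abs_fps (\<lambda>n. c ^ n * of_real (bernoulli_number n) / fact n)"
  define E where "E = fps_exp c - 1"
  have E: "(\<lambda>w. exp (c * w) - 1) has_fps_expansion E"
    unfolding E_def by (intro fps_expansion_intros)
  have BE: "B * E = fps_const c * fps_X"
  proof (rule fps_ext)
    fix n
    let ?B = "Abs_fps (\<lambda>n. of_real (bernoulli_number n) / fact n) :: complex fps"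
    have "(B * E) $ n = (\<Sum>i=0..n. c ^ n * (?B $ i * (fps_exp 1 - 1) $ (n - i)))"
      unfolding fps_mult_nth
    proof (intro sum.cong refl)
      fix i assume "i \<in> {0..n}"
      then have "c ^ n = c ^ i * c ^ (n - i)"
        by (simp flip: power_add)
      then show "B $ i * E $ (n - i) = c ^ n * (?B $ i * (fps_exp 1 - 1) $ (n - i))"
        by (auto simp: B_def E_def)
    qed
    also have "\<dots> = c ^ n * (?B * (fps_exp 1 - 1)) $ n"
      by (simp add: fps_mult_nth sum_distrib_left)
    also have "\<dots> = (fps_const c * fps_X) $ n"
      unfolding bernoulli_fps_complex by (cases "n = 1") (auto simp: fps_X_def)
    finally show "(B * E) $ n = (fps_const c * fps_X) $ n" .
  qed
  \<comment> \<open>The relation sought is w h(w) = 1 - c w / 2 - c w / (exp(c w) - 1). Multiplied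
    by exp(c w) - 1 it contains no quotient singular at 0, so both sides have expansions; the
    nonzero series \<open>E\<close> is cancelled afterwards.\<close>
  have L: "(\<lambda>w. w * h w * (exp (c * w) - 1)) has_fps_expansion fps_X * H * E"
    by (intro fps_expansion_intros H E)
  have R: "(\<lambda>w. (1 - c / 2 * w) * (exp (c * w) - 1) - c * w) has_fps_expansion
      (1 - fps_const (c / 2) * fps_X) * E - fps_const c * fps_X"
    by (intro fps_expansion_intros E)
  have eq: "\<forall>\<^sub>F w in nhds 0. w * h w * (exp (c * w) - 1) = (1 - c / 2 * w) * (exp (c * w) - 1) - c * w"
  proof -
    have "\<forall>\<^sub>F x in nhds 0. x \<in> ball (0::complex) 1"
      by (intro eventually_nhds_in_open) auto
    then show ?thesis
    proof eventually_elim
      case (elim w)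
      show ?case
      proof (cases "w = 0")
        case False
        have "w \<notin> \<int>"
          using elim False by (auto elim!: Ints_cases)
        have e: "exp (c * w) = nome w"
          by (simp add: nome_def c_def)
        have ne: "nome w \<noteq> 1"
        proof
          assume "nome w = 1"
          then obtain n :: int where "Im w = 0" "2 * pi * Re w = real_of_int (2 * n) * pi"
            by (auto simp: nome_def exp_eq_1)
          then have "w = of_int n"
            by (simp add: complex_eq_iff)
          with \<open>w \<notin> \<int>\<close> show False
            by simp
        qed
        have "h w = 1 / w - of_real pi * cot (of_real pi * w)"
          unfolding Digamma_reflection[OF \<open>w \<notin> \<int>\<close>, symmetric] h_def
          by (simp add: Digamma_plus1[OF False] add.commute[of 1])
        also have "\<dots> = 1 / w + of_real pi * \<i> * (1 + nome w) / (1 - nome w)"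
          by (simp add: cot_nome[OF ne])
        finally have h: "h w = 1 / w + of_real pi * \<i> * (1 + nome w) / (1 - nome w)" .
        have "w * h w * (nome w - 1) = (nome w - 1) - of_real pi * \<i> * w * (1 + nome w)"
        proof -
          define N where "N = nome w"
          have "w * (1 / w + P * (1 + N) / (1 - N)) * (N - 1) = (N - 1) - P * w * (1 + N)" for P
          proof -
            define Q where "Q = (1 + N) / (1 - N)"
            have Q: "Q * (N - 1) = - (1 + N)"
              using ne unfolding N_def Q_def by (simp add: divide_simps) (simp add: algebra_simps)
            have "w * (1 / w + P * Q) * (N - 1) = w * (1 / w) * (N - 1) + P * w * (Q * (N - 1))"
              by (simp add: ring_distribs mult_ac)
            then show ?thesis
              unfolding Q mult_minus_right using False by (simp add: Q_def)
          qed
          then show ?thesis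
            unfolding h N_def by blast
        qed
        then show ?thesis
          unfolding e by (simp add: c_def ring_distribs mult_ac)
      qed auto
    qed
  qed
  have "fps_X * H * E = (1 - fps_const (c / 2) * fps_X) * E - fps_const c * fps_X"
    by (rule fps_expansion_unique_complex[OF L has_fps_expansion_cong[OF eq refl, THEN iffD2, OF R]])
  also have "\<dots> = (1 - fps_const (c / 2) * fps_X - B) * E"
    by (simp add: BE algebra_simps)
  finally have "fps_X * H = 1 - fps_const (c / 2) * fps_X - B"
  proof -
    have "E $ 1 \<noteq> 0"
      by (simp add: E_def c_def)
    then have "E \<noteq> 0"
      by auto
    assume "fps_X * H * E = (1 - fps_const (c / 2) * fps_X - B) * E"
    then show ?thesis
      using \<open>E \<noteq> 0\<close> by simp
  qed
  then have "(fps_X * H) $ k = (1 - fps_const (c / 2) * fps_X - B) $ k"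
    by simp
  then have "H $ (k - 1) = - (c ^ k * of_real (bernoulli_number k) / fact k)"
    using assms by (simp add: B_def)
  moreover have "H $ (k - 1) = int_row k 0"
  proof -
    have "odd (k - 1)"
      using assms by auto
    then show ?thesis
      unfolding fps_nth_fps_expansion[OF H] by (subst higher) (simp_all add: int_row_0_eq assms)
  qed
  ultimately show ?thesis
    by (simp add: c_def)
qed

section \<open>Sums over the lattice\<close>

abbreviation lat :: "complex \<Rightarrow> int \<times> int \<Rightarrow> complex" where
  "lat \<tau> \<equiv> \<lambda>(m, n). of_int m * \<tau> + of_int n"

text \<open>This bound separates the variables and so reduces lattice sums to products of sums over
  the integers. Both \<bar>m\<bar> and \<bar>n\<bar> are at most a constant \<open>C\<close> times
  \<bar>m \<tau> + n\<bar>; away from the origin one of them is at least 1, so \<open>C\<close>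
  times the norm also absorbs the summands 1.\<close>

lemma lat_lower_bound:
  assumes "Im \<tau> > 0"
  obtains K where "K > 0"
    "\<And>m n. (1 + \<bar>real_of_int m\<bar>) * (1 + \<bar>real_of_int n\<bar>) \<le> K * norm (lat \<tau> (m, n)) ^ 2 \<or> (m = 0 \<and> n = 0)"
proof -
  define C where "C = 1 + (1 + norm \<tau>) / Im \<tau>"
  have C: "C > 0" "1 / Im \<tau> \<le> C" "1 + norm \<tau> / Im \<tau> \<le> C"
    using assms by (auto simp: C_def field_simps intro: add_pos_nonneg)
  have m: "\<bar>real_of_int m\<bar> \<le> C * norm (lat \<tau> (m, n))" for m n
  proof -
    have "\<bar>real_of_int m\<bar> * Im \<tau> = \<bar>Im (lat \<tau> (m, n))\<bar>"
      using assms by (simp add: abs_mult)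
    also have "\<dots> \<le> norm (lat \<tau> (m, n))"
      by (rule abs_Im_le_cmod)
    finally have "\<bar>real_of_int m\<bar> \<le> (1 / Im \<tau>) * norm (lat \<tau> (m, n))"
      using assms by (simp add: field_simps)
    also have "\<dots> \<le> C * norm (lat \<tau> (m, n))"
      by (rule mult_right_mono[OF C(2)]) simp
    finally show ?thesis .
  qed
  have m': "\<bar>real_of_int m\<bar> * norm \<tau> \<le> norm \<tau> / Im \<tau> * norm (lat \<tau> (m, n))" for m n
  proof -
    have "\<bar>real_of_int m\<bar> * Im \<tau> = \<bar>Im (lat \<tau> (m, n))\<bar>"
      using assms by (simp add: abs_mult)
    also have "\<dots> \<le> norm (lat \<tau> (m, n))"
      by (rule abs_Im_le_cmod)
    finally have "\<bar>real_of_int m\<bar> \<le> norm (lat \<tau> (m, n)) / Im \<tau>"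
      using assms by (simp add: field_simps)
    from mult_right_mono[OF this norm_ge_zero[of \<tau>]] show ?thesis
      by (simp add: field_simps)
  qed
  have n: "\<bar>real_of_int n\<bar> \<le> C * norm (lat \<tau> (m, n))" for m n
  proof -
    have "norm (of_int n :: complex) \<le> norm (lat \<tau> (m, n)) + norm (of_int m * \<tau>)"
      using norm_triangle_ineq4[of "lat \<tau> (m, n)" "of_int m * \<tau>"] by simp
    also have "\<dots> \<le> norm (lat \<tau> (m, n)) + norm \<tau> / Im \<tau> * norm (lat \<tau> (m, n))"
      using m'[of m n] by (simp add: norm_mult)
    also have "\<dots> = (1 + norm \<tau> / Im \<tau>) * norm (lat \<tau> (m, n))"
      by (simp add: algebra_simps)
    also have "\<dots> \<le> C * norm (lat \<tau> (m, n))"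
      by (rule mult_right_mono[OF C(3)]) simp
    finally show ?thesis by simp
  qed
  have "(1 + \<bar>real_of_int m\<bar>) * (1 + \<bar>real_of_int n\<bar>) \<le> (4 * C ^ 2) * norm (lat \<tau> (m, n)) ^ 2 \<or> (m = 0 \<and> n = 0)" for m n
  proof (cases "m = 0 \<and> n = 0")
    case False
    then have "\<bar>real_of_int m\<bar> \<ge> 1 \<or> \<bar>real_of_int n\<bar> \<ge> 1"
      by linarith
    then have 1: "1 \<le> C * norm (lat \<tau> (m, n))"
      using m[of m n] n[of n m] by linarith
    then have "(1 + \<bar>real_of_int m\<bar>) * (1 + \<bar>real_of_int n\<bar>) \<le>
        (2 * (C * norm (lat \<tau> (m, n)))) * (2 * (C * norm (lat \<tau> (m, n))))"
      using m[of m n] n[of n m] by (intro mult_mono) linarith+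
    then show ?thesis
      by (simp add: power2_eq_square algebra_simps)
  qed simp
  moreover have "4 * C ^ 2 > 0"
    using C by simp
  ultimately show ?thesis
    using that by blast
qed

lemma summable_on_int_powr:
  assumes "s < - 1"
  shows "(\<lambda>n::int. (1 + \<bar>real_of_int n\<bar>) powr s) summable_on UNIV"
proof -
  have "summable (\<lambda>n. real (Suc n) powr s)"
    using assms by (subst summable_Suc_iff[of "\<lambda>n. real n powr s"]) (simp add: summable_real_powr_iff)
  then have "(\<lambda>n. real (Suc n) powr s) summable_on UNIV"
    by (rule summable_nonneg_imp_summable_on) simp
  then have nat: "(\<lambda>n. (1 + \<bar>real_of_int (int n)\<bar>) powr s) summable_on UNIV"
    by (simp add: add.commute)
  have "(\<lambda>n::int. (1 + \<bar>real_of_int n\<bar>) powr s) summable_on range int"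
    using nat by (subst summable_on_reindex) (auto simp: o_def)
  moreover have "(\<lambda>n::int. (1 + \<bar>real_of_int n\<bar>) powr s) summable_on range (\<lambda>n. - int n)"
    using nat by (subst summable_on_reindex) (auto simp: o_def inj_def)
  ultimately have "(\<lambda>n::int. (1 + \<bar>real_of_int n\<bar>) powr s) summable_on (range int \<union> range (\<lambda>n. - int n))"
    by (rule summable_on_union)
  moreover have "x \<in> range int \<union> range (\<lambda>n. - int n)" for x
    by (cases x rule: int_cases2) simp_all
  then have "range int \<union> range (\<lambda>n. - int n) = UNIV"
    by blast
  ultimately show ?thesis
    by simp
qed

lemma summable_on_product:
  fixes f :: "'a \<Rightarrow> real" and g :: "'b \<Rightarrow> real"
  assumes "f summable_on A" "g summable_on B"
    and "\<And>x. x \<in> A \<Longrightarrow> f x \<ge> 0" "\<And>y. y \<in> B \<Longrightarrow> g y \<ge> 0"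
  shows "(\<lambda>(x, y). f x * g y) summable_on A \<times> B"
proof (rule summable_on_SigmaI)
  show "((\<lambda>y. case (x, y) of (x, y) \<Rightarrow> f x * g y) has_sum (f x * infsum g B)) B" for x
    using assms by (auto intro!: has_sum_cmult_right has_sum_infsum)
  show "(\<lambda>x. f x * infsum g B) summable_on A"
    using assms by (auto intro!: summable_on_cmult_left)
qed (use assms in auto)

text \<open>The terms are dominated by a constant times ((1 + \<bar>m\<bar>) (1 +
  \<bar>n\<bar>))^(-k/2). The exponent 3 suffices, and it is the one to which the corrected weight 2
  series is compared.\<close>

lemma summable_lat:
  assumes "Im \<tau> > 0" "k \<ge> 3"
  shows "(\<lambda>x. inverse (norm (lat \<tau> x)) ^ k) summable_on UNIV"
proof -
  obtain K where K: "K > 0"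
    "\<And>m n. (1 + \<bar>real_of_int m\<bar>) * (1 + \<bar>real_of_int n\<bar>) \<le> K * norm (lat \<tau> (m, n)) ^ 2 \<or> (m = 0 \<and> n = 0)"
    using lat_lower_bound[OF assms(1)] by blast
  define p where "p = (\<lambda>n::int. (1 + \<bar>real_of_int n\<bar>) powr (- (k / 2)))"
  have p: "p summable_on UNIV" "p n \<ge> 0" for n
    using summable_on_int_powr[of "- (k / 2)"] assms by (auto simp: p_def)
  have prod: "(\<lambda>(m, n). p m * p n) summable_on UNIV \<times> UNIV"
    by (rule summable_on_product) (use p in auto)
  have "(\<lambda>x. sqrt K ^ k * (case x of (m, n) \<Rightarrow> p m * p n)) summable_on UNIV"
    using prod by (intro summable_on_cmult_right) simp
  then show ?thesis
  proof (rule summable_on_comparison_test)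
    fix x :: "int \<times> int"
    obtain m n where x: "x = (m, n)"
      by (cases x)
    show "inverse (norm (lat \<tau> x)) ^ k \<le> sqrt K ^ k * (case x of (m, n) \<Rightarrow> p m * p n)"
    proof (cases "m = 0 \<and> n = 0")
      case True
      then show ?thesis
        using assms p K(1) by (auto simp: x power_0_left)
    next
      case False
      define M where "M = (1 + \<bar>real_of_int m\<bar>) * (1 + \<bar>real_of_int n\<bar>)"
      define r where "r = norm (lat \<tau> x)"
      have M: "M > 0" "M \<le> K * r ^ 2"
        using K(2)[of m n] False by (auto simp: M_def r_def x)
      have "r > 0"
        using M K(1) by (cases "r = 0") (auto simp: r_def)
      have "sqrt M \<le> sqrt K * r"
        using M(2) \<open>r > 0\<close> real_sqrt_le_mono[OF M(2)] by (simp add: real_sqrt_mult)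
      then have "inverse r \<le> sqrt K * inverse (sqrt M)"
        using M(1) \<open>r > 0\<close> by (simp add: field_simps)
      then have "inverse r ^ k \<le> (sqrt K * inverse (sqrt M)) ^ k"
        using \<open>r > 0\<close> by (intro power_mono) auto
      also have "\<dots> = sqrt K ^ k * inverse (sqrt M) ^ k"
        by (rule power_mult_distrib)
      also have "inverse (sqrt M) ^ k = M powr (- (k / 2))"
        using M(1) by (simp add: powr_half_sqrt[symmetric] powr_realpow[symmetric] powr_powr powr_minus power_inverse)
      also have "\<dots> = p m * p n"
        by (simp add: M_def p_def powr_mult)
      finally show ?thesis
        by (simp add: r_def x)
    qed
  qed simp
qed

text \<open>The lattice of \<tau> is \<open>j\<close> times the lattice of \<tau>'. The identity
  \<open>j * (a - c \<tau>') = 1\<close> writes the translation by 1, used in weight 2, in the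
  coordinates of the transformed lattice.\<close>

lemma lat_unimodular:
  fixes a b c d :: int
  assumes "a * d - b * c = 1" "Im \<tau> > 0"
  defines "j \<equiv> of_int c * \<tau> + of_int d" and "\<tau>' \<equiv> (of_int a * \<tau> + of_int b) / (of_int c * \<tau> + of_int d)"
  shows "j \<noteq> 0" and "lat \<tau> (m * a + n * c, m * b + n * d) = j * lat \<tau>' (m, n)"
    and "j * (of_int a - of_int c * \<tau>') = 1" and "Im \<tau>' > 0"
proof -
  show j: "j \<noteq> 0"
  proof
    assume "j = 0"
    then have "of_int c * Im \<tau> = 0" "of_int c * Re \<tau> + of_int d = 0"
      by (auto simp: j_def complex_eq_iff)
    then have "c = 0" "d = 0"
      using assms(2) by auto
    then show False
      using assms(1) by simp
  qed
  have \<tau>': "j * \<tau>' = of_int a * \<tau> + of_int b"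
    using j by (simp add: \<tau>'_def j_def)
  have "j * lat \<tau>' (m, n) = of_int m * (j * \<tau>') + of_int n * j"
    by (simp add: algebra_simps)
  then show "lat \<tau> (m * a + n * c, m * b + n * d) = j * lat \<tau>' (m, n)"
    unfolding \<tau>' by (simp add: j_def algebra_simps)
  have det: "of_int a * of_int d - of_int b * of_int c = (1 :: complex)"
    using arg_cong[OF assms(1), of "of_int :: int \<Rightarrow> complex"] by simp
  have "j * (of_int a - of_int c * \<tau>') = j * of_int a - of_int c * (j * \<tau>')"
    by (simp add: algebra_simps)
  also have "\<dots> = of_int a * of_int d - of_int b * of_int c"
    unfolding \<tau>' by (simp add: j_def algebra_simps)
  finally show "j * (of_int a - of_int c * \<tau>') = 1"
    using det by simp
  have "Im \<tau>' = Im (\<tau>' * (j * cnj j)) / norm j ^ 2"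
    using j by (simp add: complex_norm_square[symmetric])
  also have "\<tau>' * (j * cnj j) = (of_int a * \<tau> + of_int b) * cnj j"
    using \<tau>' by (simp add: mult_ac)
  also have "Im \<dots> = (real_of_int a * real_of_int d - real_of_int b * real_of_int c) * Im \<tau>"
    by (simp add: j_def algebra_simps)
  also have "real_of_int a * real_of_int d - real_of_int b * real_of_int c = real_of_int (a * d - b * c)"
    by simp
  finally show "Im \<tau>' > 0"
    using assms(1,2) j by simp
qed

lemma bij_unimodular:
  fixes a b c d :: int
  assumes "a * d - b * c = 1"
  shows "bij (\<lambda>(m, n). (m * a + n * c, m * b + n * d))"
proof (rule o_bij)
  have det: "d * a - c * b = 1"
    using assms by (simp add: mult_ac)
  have 1: "(m * a + n * c) * d - (m * b + n * d) * c = m * (a * d - b * c)"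
    "(m * b + n * d) * a - (m * a + n * c) * b = n * (a * d - b * c)"
    "(m * d - n * c) * a + (n * a - m * b) * c = m * (a * d - b * c)"
    "(m * d - n * c) * b + (n * a - m * b) * d = n * (a * d - b * c)" for m n
    by (simp_all add: algebra_simps)
  show "(\<lambda>(m, n). (m * d - n * c, n * a - m * b)) \<circ> (\<lambda>(m, n). (m * a + n * c, m * b + n * d)) = id"
    using 1 by (auto simp: fun_eq_iff assms)
  show "(\<lambda>(m, n). (m * a + n * c, m * b + n * d)) \<circ> (\<lambda>(m, n). (m * d - n * c, n * a - m * b)) = id"
    using 1 by (auto simp: fun_eq_iff assms)
qed

lemma of_int_mult_not_Ints:
  assumes "Im \<tau> > 0"
  shows "of_int m * \<tau> \<notin> \<int> \<or> of_int m * \<tau> = 0"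
  using assms by (auto elim!: Ints_cases simp: complex_eq_iff)

text \<open>Fubini for an unconditional sum. The row sums may be found from conditionally convergent
  pieces in the paired order: uniqueness of limits identifies them with the unconditional row
  sums.\<close>

lemma lat_has_sum_row_sums:
  assumes S: "(f has_sum S) (UNIV :: (int \<times> int) set)"
    and row: "\<And>m. (\<lambda>n. f (m, int n) + f (m, - 1 - int n)) sums r m"
  shows "(\<lambda>m. r (int m) + r (- 1 - int m)) sums (S :: complex)"
proof -
  have summ: "(\<lambda>(m, n). f (m, n)) summable_on Sigma UNIV (\<lambda>_. UNIV)"
    using S by (auto simp: summable_on_def)
  have "((\<lambda>n. f (m, n)) has_sum r m) UNIV" for m
  proof -
    have "((\<lambda>n. f (m, n)) has_sum infsum (\<lambda>n. f (m, n)) UNIV) UNIV"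
      using summable_on_SigmaD1[OF summ, of m] by (intro has_sum_infsum) auto
    moreover from has_sum_int_imp_sums[OF this] row have "infsum (\<lambda>n. f (m, n)) UNIV = r m"
      by (meson sums_unique2)
    ultimately show ?thesis by simp
  qed
  moreover have "(f has_sum S) (Sigma UNIV (\<lambda>_. UNIV))"
    using S by (simp only: UNIV_Times_UNIV)
  ultimately have "(r has_sum S) UNIV"
    by (rule has_sum_SigmaD[rotated])
  then show ?thesis
    by (rule has_sum_int_imp_sums)
qed

text \<open>Eisenstein's order of summation, rows first, so that the definition also makes sense in
  weight 2, where the double series does not converge absolutely.\<close>

definition lat_sum :: "nat \<Rightarrow> complex \<Rightarrow> complex" where
  "lat_sum k \<tau> = (\<Sum>m. int_row k (of_int (int m) * \<tau>) + int_row k (of_int (- 1 - int m) * \<tau>))"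

text \<open>For \<open>k >= 4\<close> absolute convergence permits reindexing by the unimodular map,
  which takes the factor \<open>j ^ k\<close> out of each denominator.\<close>

lemma lat_sum_modular:
  fixes a b c d :: int
  assumes det: "a * d - b * c = 1" and "Im \<tau> > 0" "even k" "k \<ge> 4"
  defines "j \<equiv> of_int c * \<tau> + of_int d" and "\<tau>' \<equiv> (of_int a * \<tau> + of_int b) / (of_int c * \<tau> + of_int d)"
  shows "lat_sum k \<tau>' = j ^ k * lat_sum k \<tau>"
proof -
  note uni = lat_unimodular[OF det \<open>Im \<tau> > 0\<close>, folded j_def \<tau>'_def]
  define S where "S = infsum (\<lambda>x. inverse (lat \<tau> x ^ k)) UNIV"
  have "(\<lambda>x. norm (inverse (lat \<tau> x ^ k))) summable_on UNIV"
    using summable_lat[OF \<open>Im \<tau> > 0\<close>, of k] assms by (simp add: norm_inverse norm_power power_inverse)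
  then have S: "((\<lambda>x. inverse (lat \<tau> x ^ k)) has_sum S) UNIV"
    unfolding S_def by (intro has_sum_infsum) (rule abs_summable_summable)
  have row: "(\<lambda>n. inverse (lat \<tau> (m, int n) ^ k) + inverse (lat \<tau> (m, - 1 - int n) ^ k)) sums
      int_row k (of_int m * \<tau>)" if "Im \<tau> > 0" for \<tau> m
    using sums_int_row[of k "of_int m * \<tau>"] of_int_mult_not_Ints[OF that] assms by simp
  have 1: "lat_sum k \<tau> = S"
    using lat_has_sum_row_sums[OF S row[OF \<open>Im \<tau> > 0\<close>]] by (simp add: sums_iff lat_sum_def)
  have "((\<lambda>x. inverse (lat \<tau> ((\<lambda>(m, n). (m * a + n * c, m * b + n * d)) x) ^ k)) has_sum S) UNIV"
    using has_sum_reindex_bij_betw[OF bij_unimodular[OF det], of "\<lambda>x. inverse (lat \<tau> x ^ k)"] S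
    by simp
  moreover have "inverse (lat \<tau> ((\<lambda>(m, n). (m * a + n * c, m * b + n * d)) x) ^ k) =
      inverse (j ^ k) * inverse (lat \<tau>' x ^ k)" for x
    using uni(2)[of "fst x" "snd x"] by (simp add: case_prod_unfold power_mult_distrib)
  ultimately have "((\<lambda>x. inverse (j ^ k) * inverse (lat \<tau>' x ^ k)) has_sum S) UNIV"
    by simp
  from has_sum_cmult_right[OF this, of "j ^ k"] have "((\<lambda>x. inverse (lat \<tau>' x ^ k)) has_sum (j ^ k * S)) UNIV"
    using uni(1) by (simp add: mult.assoc[symmetric])
  from lat_has_sum_row_sums[OF this row[OF uni(4)]] have 2: "lat_sum k \<tau>' = j ^ k * S"
    by (simp add: sums_iff lat_sum_def)
  show ?thesis
    using 1 2 by simp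
qed

section \<open>The quasimodular lattice sum of weight 2\<close>

text \<open>The factor 2 is needed only at \<open>w = - 1\<close>, because of \<open>1/0 = 0\<close>.\<close>

lemma norm_telescoped_inverse_square:
  "norm (inverse (w ^ 2) - inverse w + inverse (w + 1) :: complex) \<le>
    2 * (inverse (norm w) ^ 3 + inverse (norm (w + 1)) ^ 3)"
proof (cases "w = 0 \<or> w + 1 = 0")
  case True
  then have "w = 0 \<or> w = - 1"
    by (metis add_eq_0_iff2)
  then show ?thesis
    by auto
next
  case False
  define x y where "x = inverse (norm w)" and "y = inverse (norm (w + 1))"
  have xy: "x > 0" "y > 0"
    using False by (auto simp: x_def y_def)
  have "inverse (w ^ 2) - inverse w + inverse (w + 1) = inverse w ^ 2 * inverse (w + 1)"
    using False by (simp add: divide_simps power2_eq_square) (simp add: algebra_simps)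
  then have "norm (inverse (w ^ 2) - inverse w + inverse (w + 1)) = x ^ 2 * y"
    by (simp add: norm_mult norm_power norm_inverse x_def y_def)
  also have "\<dots> \<le> x ^ 3 + y ^ 3"
  proof (cases "x \<le> y")
    case True
    then have "x ^ 2 * y \<le> y ^ 2 * y"
      using xy by (intro mult_right_mono power_mono) auto
    then show ?thesis
      using xy by (simp add: power2_eq_square power3_eq_cube add_nonneg_nonneg add_increasing)
  next
    case False
    then have "x ^ 2 * y \<le> x ^ 2 * x"
      using xy by (intro mult_left_mono) auto
    then show ?thesis
      using xy by (simp add: power2_eq_square power3_eq_cube add_increasing2)
  qed
  also have "\<dots> \<le> 2 * (x ^ 3 + y ^ 3)"
    using xy by simp
  finally show ?thesis
    by (simp add: x_def y_def)
qed

lemma summable_telescoped_lat: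
  assumes "Im \<tau> > 0"
  shows "(\<lambda>x. inverse (lat \<tau> x ^ 2) - inverse (lat \<tau> x) + inverse (lat \<tau> x + 1)) summable_on UNIV"
proof -
  have 1: "(\<lambda>x. inverse (norm (lat \<tau> x)) ^ 3) summable_on UNIV"
    using summable_lat[OF assms] by simp
  have "bij (\<lambda>(m, n). (m, n + 1 :: int) :: int \<times> int)"
    by (rule o_bij[of "\<lambda>(m, n). (m, n - 1)"]) auto
  from summable_on_reindex_bij_betw[OF this, of "\<lambda>x. inverse (norm (lat \<tau> x)) ^ 3"] 1
  have 2: "(\<lambda>x. inverse (norm (lat \<tau> x + 1)) ^ 3) summable_on UNIV"
    by (simp add: case_prod_unfold add.assoc)
  have "(\<lambda>x. 2 * (inverse (norm (lat \<tau> x)) ^ 3 + inverse (norm (lat \<tau> x + 1)) ^ 3)) summable_on UNIV"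
    by (intro summable_on_cmult_right summable_on_add 1 2)
  then have "(\<lambda>x. norm (inverse (lat \<tau> x ^ 2) - inverse (lat \<tau> x) + inverse (lat \<tau> x + 1))) summable_on UNIV"
  proof (rule Infinite_Sum.abs_summable_on_comparison_test')
    fix x :: "int \<times> int"
    show "norm (inverse (lat \<tau> x ^ 2) - inverse (lat \<tau> x) + inverse (lat \<tau> x + 1)) \<le>
        2 * (inverse (norm (lat \<tau> x)) ^ 3 + inverse (norm (lat \<tau> x + 1)) ^ 3)"
      by (rule norm_telescoped_inverse_square)
  qed
  then show ?thesis
    by (rule abs_summable_summable)
qed

text \<open>Here q^n tends to 0 and the cotangent is odd. That the two limits differ is the source
  of the quasimodular correction.\<close>

lemma cot_lat_limits:
  assumes "Im \<tau> > 0"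
  shows "(\<lambda>n. of_real pi * cot (of_real pi * (of_int (int n) * \<tau>))) \<longlonglongrightarrow> - of_real pi * \<i>"
    and "(\<lambda>n. of_real pi * cot (of_real pi * (of_int (- int n) * \<tau>))) \<longlonglongrightarrow> of_real pi * \<i>"
proof -
  define x where "x = nome \<tau>"
  have x: "norm x < 1"
    using norm_nome_less_1[OF assms] by (simp add: x_def)
  have lim: "(\<lambda>n. - of_real pi * \<i> * (1 + x ^ n) / (1 - x ^ n)) \<longlonglongrightarrow> - of_real pi * \<i> * (1 + 0) / (1 - 0)"
    by (intro tendsto_intros LIMSEQ_power_zero x) auto
  have ev: "\<forall>\<^sub>F n in sequentially. - of_real pi * \<i> * (1 + x ^ n) / (1 - x ^ n) =
      of_real pi * cot (of_real pi * (of_int (int n) * \<tau>))"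
    using eventually_gt_at_top[of 0]
  proof eventually_elim
    case (elim n)
    have e: "nome (of_int (int n) * \<tau>) = x ^ n"
      by (simp add: nome_of_nat_mult x_def)
    have "norm (x ^ n) < 1"
      using x elim by (simp add: norm_power power_less_one_iff)
    then have "nome (of_int (int n) * \<tau>) \<noteq> 1"
      unfolding e by auto
    from cot_nome[OF this] show ?case
      unfolding e by simp
  qed
  show 1: "(\<lambda>n. of_real pi * cot (of_real pi * (of_int (int n) * \<tau>))) \<longlonglongrightarrow> - of_real pi * \<i>"
    using Lim_transform_eventually[OF lim ev] by simp
  from tendsto_minus[OF this]
  show "(\<lambda>n. of_real pi * cot (of_real pi * (of_int (- int n) * \<tau>))) \<longlonglongrightarrow> of_real pi * \<i>"
    by simp
qed

text \<open>The integer \<open>c\<close> is invisible to the cotangent, the complex shift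
  \<open>v\<close> is not. The case \<open>c = 1\<close>, \<open>v = 0\<close> serves the original
  lattice and gives 0; \<open>c = a\<close>, \<open>v = c \<tau>'\<close> (with the matrix entries
  \<open>a\<close> and \<open>c\<close>) serves the transformed one.\<close>

lemma sums_telescoped_row:
  fixes w v :: complex
  shows "(\<lambda>n. (inverse (w + of_int (int n)) - inverse (w + of_int (int n) + of_int c - v)) +
      (inverse (w + of_int (- 1 - int n)) - inverse (w + of_int (- 1 - int n) + of_int c - v))) sums
    (of_real pi * cot (of_real pi * w) - of_real pi * cot (of_real pi * (w - v)))"
  using sums_diff[OF sums_cot[of w] sums_cot_shift[of "w - v" c]] by (simp add: algebra_simps)

text \<open>Along each row of the original lattice the correction 1/w - 1/(w + 1) sums to 0, so the
  unconditional sum has the rows \<open>int_row 2\<close> and agrees with Eisenstein's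
  order.\<close>

lemma lat_sum_2_sums:
  assumes "Im \<tau> > 0"
  shows "(\<lambda>m. int_row 2 (of_int (int m) * \<tau>) + int_row 2 (of_int (- 1 - int m) * \<tau>)) sums lat_sum 2 \<tau>"
    and "((\<lambda>x. inverse (lat \<tau> x ^ 2) - inverse (lat \<tau> x) + inverse (lat \<tau> x + 1)) has_sum lat_sum 2 \<tau>) UNIV"
proof -
  let ?f = "\<lambda>x. inverse (lat \<tau> x ^ 2) - inverse (lat \<tau> x) + inverse (lat \<tau> x + 1)"
  define S where "S = infsum ?f UNIV"
  have S: "(?f has_sum S) UNIV"
    unfolding S_def by (rule has_sum_infsum[OF summable_telescoped_lat[OF assms]])
  have row: "(\<lambda>n. ?f (m, int n) + ?f (m, - 1 - int n)) sums int_row 2 (of_int m * \<tau>)" for m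
    using sums_diff[OF sums_int_row[of 2, OF _ _ of_int_mult_not_Ints[OF assms, of m]]
        sums_telescoped_row[of "of_int m * \<tau>" 1 0]]
    by (simp add: algebra_simps)
  from lat_has_sum_row_sums[OF S row]
  have "(\<lambda>m. int_row 2 (of_int (int m) * \<tau>) + int_row 2 (of_int (- 1 - int m) * \<tau>)) sums S" .
  moreover from this have "S = lat_sum 2 \<tau>"
    by (simp add: lat_sum_def sums_iff)
  ultimately show "(\<lambda>m. int_row 2 (of_int (int m) * \<tau>) + int_row 2 (of_int (- 1 - int m) * \<tau>)) sums lat_sum 2 \<tau>"
    and "(?f has_sum lat_sum 2 \<tau>) UNIV"
    using S by simp_all
qed

text \<open>
  With \<open>w = j v\<close> and \<open>v = m \<tau>' + n\<close> one has \<open>w + 1 = j (v + a - c \<tau>')\<close>, so that row \<open>m\<close> of the transformed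
  lattice contributes a difference of cotangents at \<open>m \<tau>'\<close> and \<open>(m - c) \<tau>'\<close>. These differences telescope over \<open>m\<close>.
\<close>

lemma lat_sum_2_modular:
  fixes a b c d :: int
  assumes det: "a * d - b * c = 1" and "Im \<tau> > 0"
  defines "j \<equiv> of_int c * \<tau> + of_int d" and "\<tau>' \<equiv> (of_int a * \<tau> + of_int b) / (of_int c * \<tau> + of_int d)"
  shows "lat_sum 2 \<tau>' = j ^ 2 * lat_sum 2 \<tau> - 2 * of_real pi * \<i> * of_int c * j"
proof -
  note uni = lat_unimodular[OF det \<open>Im \<tau> > 0\<close>, folded j_def \<tau>'_def]
  let ?f = "\<lambda>w. inverse (w ^ 2) - inverse w + inverse (w + 1) :: complex"
  let ?C = "\<lambda>w. of_real pi * cot (of_real pi * w) :: complex"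
  have "((\<lambda>x. ?f (lat \<tau> ((\<lambda>(m, n). (m * a + n * c, m * b + n * d)) x))) has_sum lat_sum 2 \<tau>) UNIV"
    using has_sum_reindex_bij_betw[OF bij_unimodular[OF det], of "\<lambda>x. ?f (lat \<tau> x)"]
      lat_sum_2_sums(2)[OF \<open>Im \<tau> > 0\<close>]
    by simp
  moreover have "?f (lat \<tau> ((\<lambda>(m, n). (m * a + n * c, m * b + n * d)) x)) =
      inverse (j ^ 2) * inverse (lat \<tau>' x ^ 2) -
      inverse j * (inverse (lat \<tau>' x) - inverse (lat \<tau>' x + of_int a - of_int c * \<tau>'))" for x
  proof -
    have *: "lat \<tau> ((\<lambda>(m, n). (m * a + n * c, m * b + n * d)) x) = j * lat \<tau>' x"
      using uni(2)[of "fst x" "snd x"] by (simp add: case_prod_unfold)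
    define X where "X = lat \<tau>' x + of_int a - of_int c * \<tau>'"
    have "j * lat \<tau>' x + 1 = j * X"
      using uni(3) by (simp add: X_def algebra_simps)
    then show ?thesis
      unfolding * X_def[symmetric] by (simp add: power_mult_distrib right_diff_distrib)
  qed
  ultimately have S: "((\<lambda>x. inverse (j ^ 2) * inverse (lat \<tau>' x ^ 2) -
      inverse j * (inverse (lat \<tau>' x) - inverse (lat \<tau>' x + of_int a - of_int c * \<tau>'))) has_sum lat_sum 2 \<tau>) UNIV"
    (is "(?g has_sum _) _")
    by simp
  define r where "r = (\<lambda>m::int. inverse (j ^ 2) * int_row 2 (of_int m * \<tau>') -
      inverse j * (?C (of_int m * \<tau>') - ?C (of_int (m - c) * \<tau>')))"
  have row: "(\<lambda>n. ?g (m, int n) + ?g (m, - 1 - int n)) sums r m" for m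
    using sums_diff[OF
        sums_mult[OF sums_int_row[of 2, OF _ _ of_int_mult_not_Ints[OF uni(4), of m]], of "inverse (j ^ 2)"]
        sums_mult[OF sums_telescoped_row[of "of_int m * \<tau>'" a "of_int c * \<tau>'"], of "inverse j"]]
    by (simp add: r_def algebra_simps)
  have "(\<lambda>m. r (int m) + r (- 1 - int m)) sums (inverse (j ^ 2) * lat_sum 2 \<tau>' -
      inverse j * (of_int c * (- of_real pi * \<i> - of_real pi * \<i>)))"
    using sums_diff[OF sums_mult[OF lat_sum_2_sums(1)[OF uni(4)], of "inverse (j ^ 2)"]
        sums_mult[OF sums_int_shift[of "\<lambda>m. ?C (of_int m * \<tau>')", OF cot_lat_limits[OF uni(4)], of c], of "inverse j"]]
    by (simp add: r_def algebra_simps)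
  with lat_has_sum_row_sums[OF S row] have "lat_sum 2 \<tau> = inverse (j ^ 2) * lat_sum 2 \<tau>' -
      inverse j * (of_int c * (- of_real pi * \<i> - of_real pi * \<i>))"
    by (rule sums_unique2)
  then have "j ^ 2 * lat_sum 2 \<tau> = lat_sum 2 \<tau>' + 2 * of_real pi * \<i> * of_int c * j"
    using uni(1) by (simp add: field_simps power2_eq_square)
  then show ?thesis
    by simp
qed

section \<open>Eisenstein series\<close>

lemma divisor_sigma_of_nat:
  "divisor_sigma r (real n) = (if n > 0 then \<Sum>d | d dvd n. d ^ r else 0)"
  by (simp add: divisor_sigma_def)

definition eis_fps :: "nat \<Rightarrow> complex \<Rightarrow> complex fps" where
  "eis_fps k c = Abs_fps (\<lambda>n. if n = 0 then c else of_nat (divisor_sigma (k - 1) (real n)))"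

text \<open>Lambert series: collect the terms with the same exponent \<open>m * n\<close>. Absolute
  convergence follows from \<open>m * n >= (m - 1) + n\<close>, which bounds the double series by a
  product of two convergent ones. Both sums are needed with the same value, one for the lattice rows
  and one for the q-expansion.\<close>

lemma lambert_has_sum:
  fixes x :: complex
  assumes x: "norm x < 1" and "p > 0"
  obtains U where
    "((\<lambda>(m, n). of_nat n ^ p * x ^ (m * n)) has_sum U) ({1..} \<times> {1..})"
    "(\<lambda>n. of_nat (divisor_sigma p (real n)) * x ^ n) sums U"
proof -
  define r where "r = norm x"
  have r: "0 \<le> r" "r < 1"
    using x by (auto simp: r_def)
  let ?f = "\<lambda>(m, n). of_nat n ^ p * x ^ (m * n)"
  \<comment> \<open>Up to a constant, the coefficients of \<open>cot_fps p\<close> have absolute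
    value \<open>n ^ p\<close>, so its radius of convergence gives the summability of
    \<open>n ^ p * r ^ n\<close>.\<close>
  have "summable (\<lambda>n. norm (cot_fps p $ n * of_real r ^ n))"
  proof (rule norm_summable_fps)
    show "ereal (norm (of_real r :: complex)) < fps_conv_radius (cot_fps p)"
      using r by (intro less_conv_radiusI conv_radius_cot_fps) simp
  qed
  moreover have "norm (cot_fps p $ n * of_real r ^ n) = (2 * pi) ^ Suc p * (real n ^ p * r ^ n)" for n
    using r \<open>p > 0\<close> by (simp add: cot_fps_def norm_mult norm_power power_mult_distrib)
  ultimately have "summable (\<lambda>n. (2 * pi) ^ Suc p * (real n ^ p * r ^ n))"
    by simp
  then have "summable (\<lambda>n. real n ^ p * r ^ n)"
    by (subst (asm) summable_cmult_iff) auto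
  then have np: "(\<lambda>n. real n ^ p * r ^ n) summable_on {1..}"
    by (intro summable_on_subset[OF summable_nonneg_imp_summable_on]) (use r in auto)
  have "summable (\<lambda>m. r ^ (m - 1))"
    using summable_geometric[of r] r by (subst summable_Suc_iff[symmetric]) simp
  then have rp: "(\<lambda>m. r ^ (m - 1)) summable_on {1..}"
    by (intro summable_on_subset[OF summable_nonneg_imp_summable_on]) (use r in auto)
  have "(\<lambda>(m, n). r ^ (m - 1) * (real n ^ p * r ^ n)) summable_on ({1..} \<times> {1..})"
    using rp np by (rule summable_on_product) (use r in auto)
  then have "(\<lambda>y. norm (?f y)) summable_on ({1..} \<times> {1..})"
  proof (rule Infinite_Sum.abs_summable_on_comparison_test')
    fix y :: "nat \<times> nat"
    assume "y \<in> {1..} \<times> {1..}"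
    then obtain m n where y: "y = (m, n)" "m \<ge> 1" "n \<ge> 1"
      by auto
    then have "m * n \<ge> (m - 1) + n"
      by (cases m; cases n) auto
    then have "r ^ (m * n) \<le> r ^ ((m - 1) + n)"
      using r by (intro power_decreasing) auto
    then have "real n ^ p * r ^ (m * n) \<le> real n ^ p * r ^ ((m - 1) + n)"
      by (intro mult_left_mono) auto
    then show "norm (?f y) \<le> (case y of (m, n) \<Rightarrow> r ^ (m - 1) * (real n ^ p * r ^ n))"
      by (simp add: y r_def norm_mult norm_power power_add mult_ac)
  qed
  then have "?f summable_on ({1..} \<times> {1..})"
    by (rule abs_summable_summable)
  then obtain U where U: "(?f has_sum U) ({1..} \<times> {1..})"
    by (auto simp: summable_on_def)
  have "((\<lambda>(N, d). of_nat d ^ p * x ^ N) has_sum U) (Sigma {1..} (\<lambda>N. {d. d dvd N}))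
      \<longleftrightarrow> (?f has_sum U) ({1..} \<times> {1..})"
    by (rule has_sum_reindex_bij_witness[of _ "\<lambda>(m, n). (m * n, n)" "\<lambda>(N, d). (N div d, d)"])
      (auto simp: Suc_le_eq dvd_pos_nat dvd_div_eq_0_iff mult.commute elim!: dvdE intro!: Nat.gr0I)
  with U have "((\<lambda>(N, d). of_nat d ^ p * x ^ N) has_sum U) (Sigma {1..} (\<lambda>N. {d. d dvd N}))"
    by blast
  then have "((\<lambda>N. of_nat (divisor_sigma p (real N)) * x ^ N) has_sum U) {1..}"
  proof (rule has_sum_SigmaD)
    fix N :: nat assume N: "N \<in> {1..}"
    show "((\<lambda>d. case (N, d) of (N, d) \<Rightarrow> of_nat d ^ p * x ^ N) has_sum
        (of_nat (divisor_sigma p (real N)) * x ^ N)) {d. d dvd N}"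
      using N by (intro has_sum_finiteI) (auto simp: divisor_sigma_of_nat sum_distrib_right)
  qed
  also have "?this \<longleftrightarrow> ((\<lambda>N. of_nat (divisor_sigma p (real N)) * x ^ N) has_sum U) UNIV"
    by (rule has_sum_cong_neutral) (auto simp: divisor_sigma_of_nat)
  finally have "(\<lambda>n. of_nat (divisor_sigma p (real n)) * x ^ n) sums U"
    by (rule has_sum_imp_sums)
  with U show ?thesis
    using that by blast
qed

lemma conv_radius_eis_fps:
  assumes "k \<ge> 2"
  shows "fps_conv_radius (eis_fps k c) \<ge> 1"
proof (rule fps_conv_radius_ge_1I)
  fix x :: complex assume x: "norm x < 1"
  have "k - 1 > 0"
    using assms by simp
  then obtain U where "(\<lambda>n. of_nat (divisor_sigma (k - 1) (real n)) * x ^ n) sums U"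
    by (rule lambert_has_sum[OF x])
  from sums_add[OF this sums_single[of 0 "\<lambda>_. c"]]
  have "summable (\<lambda>n. of_nat (divisor_sigma (k - 1) (real n)) * x ^ n + (if n = 0 then c else 0))"
    by (rule sums_summable)
  moreover have "of_nat (divisor_sigma (k - 1) (real n)) * x ^ n + (if n = 0 then c else 0) = eis_fps k c $ n * x ^ n" for n
    by (simp add: eis_fps_def divisor_sigma_of_nat)
  ultimately show "summable (\<lambda>n. eis_fps k c $ n * x ^ n)"
    by simp
qed

definition eis :: "nat \<Rightarrow> complex \<Rightarrow> complex" where
  "eis k z = eval_fps (eis_fps k (- of_real (bernoulli_number k) / (2 * of_nat k))) (nome z)"

text \<open>Row 0 is twice a zeta value and yields the constant term through the Bernoulli number.
  The rows \<open>m\<close> and \<open>- m\<close> agree, and Lipschitz's formula turns the positive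
  ones into a Lambert series; this doubling is the leading factor 2.\<close>

lemma lat_sum_eis:
  assumes "even k" "k \<ge> 2" "Im \<tau> > 0"
  shows "lat_sum k \<tau> = 2 * (2 * of_real pi * \<i>) ^ k / fact (k - 1) * eis k \<tau>"
proof -
  define p where "p = k - 1"
  have p: "p > 0" "k = Suc p" "odd p"
    using assms by (auto simp: p_def)
  define x where "x = nome \<tau>"
  have x: "norm x < 1"
    using norm_nome_less_1[OF assms(3)] by (simp add: x_def)
  define C where "C = (2 * of_real pi * \<i> :: complex) ^ k / fact p"
  obtain U where U: "((\<lambda>(m, n). of_nat n ^ p * x ^ (m * n)) has_sum U) ({1..} \<times> {1..})"
    "(\<lambda>n. of_nat (divisor_sigma p (real n)) * x ^ n) sums U"
    using lambert_has_sum[OF x p(1)] by blast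
  define s where "s = (\<lambda>m. int_row k (of_nat m * \<tau>))"
  have row: "((\<lambda>n. C * (of_nat n ^ p * x ^ (m * n))) has_sum s m) {1..}" if "m \<ge> 1" for m
  proof -
    have Im: "Im (of_nat m * \<tau>) > 0"
      using assms(3) that by simp
    have n: "norm (x ^ m) < 1"
      using norm_nome_less_1[OF Im] by (simp add: nome_of_nat_mult x_def)
    then have "ereal (norm (x ^ m)) < fps_conv_radius (cot_fps p)"
      by (intro less_conv_radiusI conv_radius_cot_fps)
    then have "((\<lambda>n. cot_fps p $ n * (x ^ m) ^ n) has_sum eval_fps (cot_fps p) (x ^ m)) UNIV"
      by (intro norm_summable_imp_has_sum sums_eval_fps norm_summable_fps)
    from has_sum_cmult_right[OF this, of "- 1 / fact p"]
    have "((\<lambda>n. - 1 / fact p * (cot_fps p $ n * (x ^ m) ^ n)) has_sum s m) UNIV"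
      using int_row_nome[OF assms(1,2) Im] by (simp add: s_def nome_of_nat_mult x_def p_def)
    moreover have "- 1 / fact p * (cot_fps p $ n * (x ^ m) ^ n) = C * (of_nat n ^ p * x ^ (m * n))" for n
      using p by (simp add: cot_fps_def C_def power_mult power_mult_distrib)
    ultimately have "((\<lambda>n. C * (of_nat n ^ p * x ^ (m * n))) has_sum s m) UNIV"
      by (simp only:)
    then show ?thesis
      by (rule has_sum_cong_neutral[THEN iffD1, rotated -1]) (use p in auto)
  qed
  have "(s has_sum (C * U)) {1..}"
  proof (rule has_sum_SigmaD)
    show "((\<lambda>(m, n). C * (of_nat n ^ p * x ^ (m * n))) has_sum (C * U)) ({1..} \<times> {1..})"
      using has_sum_cmult_right[OF U(1), of C] by (simp add: case_prod_unfold)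
  qed (use row in auto)
  also have "?this \<longleftrightarrow> ((\<lambda>m. s (Suc m)) has_sum (C * U)) UNIV"
    by (rule has_sum_reindex_bij_witness[of _ Suc "\<lambda>m. m - 1"]) auto
  finally have s1: "(\<lambda>m. s (Suc m)) sums (C * U)"
    by (rule has_sum_imp_sums)
  \<comment> \<open>Under the pairing of \<open>m\<close> with \<open>- 1 - m\<close> the first
    entries run through the rows 0, 1, 2, ... and the second through -1, -2, ...; row 0 is therefore
    counted once.\<close>
  then have s0: "s sums (C * U + s 0)"
    by (subst (asm) sums_Suc_iff) simp
  have "int_row k (of_int (- 1 - int m) * \<tau>) = s (Suc m)" for m
  proof -
    have "of_nat (Suc m) * \<tau> \<notin> \<int>"
      using Im_pos_not_Ints[of "of_nat (Suc m) * \<tau>"] assms(3) by simp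
    from int_row_minus[OF assms(1,2) this] show ?thesis
      by (simp add: s_def algebra_simps)
  qed
  with sums_add[OF s0 s1] have "lat_sum k \<tau> = s 0 + 2 * C * U"
    by (simp add: lat_sum_def sums_iff s_def)
  also have "s 0 = 2 * C * (- of_real (bernoulli_number k) / (2 * of_nat k))"
  proof -
    have "fact k = of_nat k * (fact p :: complex)"
      by (simp add: p fact_Suc)
    then show ?thesis
      using assms by (simp add: s_def int_row_0_bernoulli C_def)
  qed
  also have "2 * C * (- of_real (bernoulli_number k) / (2 * of_nat k)) + 2 * C * U = 2 * C * eis k \<tau>"
  proof -
    let ?c = "- of_real (bernoulli_number k) / (2 * of_nat k) :: complex"
    have "(\<lambda>n. of_nat (divisor_sigma p (real n)) * x ^ n + (if n = 0 then ?c else 0)) sums (U + ?c)"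
      using sums_add[OF U(2) sums_single[of 0 "\<lambda>_. ?c"]] .
    moreover have "of_nat (divisor_sigma p (real n)) * x ^ n + (if n = 0 then ?c else 0) = eis_fps k ?c $ n * x ^ n" for n
      by (simp add: eis_fps_def divisor_sigma_of_nat p_def)
    ultimately have "eis k \<tau> = U + ?c"
      by (simp add: eis_def eval_fps_def sums_iff x_def)
    then show ?thesis
      by (simp only: distrib_left add.commute)
  qed
  finally show ?thesis
    by (simp add: C_def p_def)
qed

lemma eis_modular:
  fixes a b c d :: int
  assumes "a * d - b * c = 1" "Im \<tau> > 0" "even k" "k \<ge> 4"
  shows "eis k ((of_int a * \<tau> + of_int b) / (of_int c * \<tau> + of_int d)) = (of_int c * \<tau> + of_int d) ^ k * eis k \<tau>"
  using lat_sum_modular[OF assms] lat_unimodular(4)[OF assms(1,2)] assms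
  by (simp add: lat_sum_eis)

lemma eis_2_modular:
  fixes a b c d :: int
  assumes "a * d - b * c = 1" "Im \<tau> > 0"
  shows "eis 2 ((of_int a * \<tau> + of_int b) / (of_int c * \<tau> + of_int d)) = (of_int c * \<tau> + of_int d) ^ 2 * eis 2 \<tau>
    - of_int c * (of_int c * \<tau> + of_int d) / (4 * of_real pi * \<i>)"
proof -
  let ?j = "of_int c * \<tau> + of_int d" and ?t = "(of_int a * \<tau> + of_int b) / (of_int c * \<tau> + of_int d)"
  have "2 * (2 * of_real pi * \<i>) ^ 2 * eis 2 ?t = ?j ^ 2 * (2 * (2 * of_real pi * \<i>) ^ 2 * eis 2 \<tau>)
      - 2 * of_real pi * \<i> * of_int c * ?j"
    using lat_sum_2_modular[OF assms] lat_unimodular(4)[OF assms] assms(2) by (simp add: lat_sum_eis)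
  also have "\<dots> = 2 * (2 * of_real pi * \<i>) ^ 2 * (?j ^ 2 * eis 2 \<tau> - of_int c * ?j / (4 * of_real pi * \<i>))"
    by (simp add: field_simps power2_eq_square)
  finally show ?thesis
    by simp
qed

text \<open>By Euler's formula B_k is a nonzero multiple of a polygamma value of odd order at 1,
  which is positive.\<close>

lemma bernoulli_number_nonzero:
  assumes "even k" "k \<ge> 2"
  shows "bernoulli_number k \<noteq> 0"
proof -
  have "Polygamma (k - 1) (1 :: real) > 0"
    using assms by (intro Polygamma_real_odd_pos) auto
  moreover have "Polygamma (k - 1) (1 :: complex) = of_real (Polygamma (k - 1) (1 :: real))"
    using Polygamma_of_real[of "1 :: real" "k - 1", where 'a = complex] by simp
  ultimately have "int_row k 0 \<noteq> 0"
    using assms by (simp add: int_row_0_eq)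
  then show ?thesis
    using assms by (auto simp: int_row_0_bernoulli)
qed

lemma bernoulli_number_2: "bernoulli_number 2 = 1 / 6"
proof -
  define B where "B = (\<lambda>n. complex_of_real (bernoulli_number n) / fact n)"
  have c: "(\<Sum>i=0..n. B i * (fps_exp 1 - 1 :: complex fps) $ (n - i)) = fps_X $ n" for n
    using arg_cong[OF bernoulli_fps_complex, of "\<lambda>F. F $ n"] by (simp add: fps_mult_nth B_def)
  have "B 0 = 1" "1 + B 1 * 2 = 0" "1 + (B 1 * 3 + B 2 * 6) = 0"
    using c[of 1] c[of 2] c[of 3] by (simp_all add: numeral_eq_Suc fact_Suc field_simps)
  then have "B 2 * 12 = 1"
    by algebra
  then have "B 2 = 1 / 12"
    by (simp add: field_simps)
  then have "complex_of_real (bernoulli_number 2) = complex_of_real (1 / 6)"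
    by (simp add: B_def field_simps)
  then show ?thesis
    by (simp only: of_real_eq_iff)
qed

section \<open>Holomorphy at the cusp and the bracket\<close>

lemma in_upper_half_plane [simp]: "z \<in> upper_half_plane \<longleftrightarrow> Im z > 0"
  by (simp add: upper_half_plane_def)

lemma open_upper_half_plane: "open upper_half_plane"
  unfolding upper_half_plane_def by (rule open_halfspace_Im_gt)

lemma exp_in_unit_ball:
  assumes "Im z > 0" "h > 0"
  shows "exp (2 * of_real pi * \<i> * z / of_nat h) \<in> ball (0::complex) 1"
  using assms by (simp add: divide_complex_def)

text \<open>The power refines the coordinate to a larger width; the unit \<open>u\<close> is the
  effect of a real translation of z.\<close>

lemma holomorphic_compose_power:
  assumes "H holomorphic_on ball 0 1" "m > 0" "norm (u::complex) = 1"
  shows "(\<lambda>w. H (u * w ^ m)) holomorphic_on ball 0 1"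
proof -
  have "(\<lambda>w::complex. u * w ^ m) ` ball 0 1 \<subseteq> ball 0 1"
    using assms by (auto simp: norm_mult norm_power power_less_one_iff)
  moreover have "(\<lambda>w. u * w ^ m) holomorphic_on ball 0 1"
    by (intro holomorphic_intros)
  ultimately show ?thesis
    using holomorphic_on_compose_gen[of "\<lambda>w. u * w ^ m" "ball 0 1" H "ball 0 1"] assms(1)
    unfolding o_def by blast
qed

lemma exp_divide_power:
  assumes "h > 0" "h' > 0"
  shows "exp (2 * of_real pi * \<i> * z / of_nat (h * h')) ^ h' = exp (2 * of_real pi * \<i> * z / of_nat h)"
  using assms by (simp flip: exp_of_nat_mult)

lemma holomorphic_at_i_infinity_cong:
  assumes "\<And>z. Im z > 0 \<Longrightarrow> f z = g z"
  shows "holomorphic_at_i_infinity f \<longleftrightarrow> holomorphic_at_i_infinity g"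
  unfolding holomorphic_at_i_infinity_def using assms by simp

text \<open>The widths of \<open>f\<close> and \<open>g\<close> may differ; their product serves
  both.\<close>

lemma holomorphic_at_i_infinity_common:
  assumes "holomorphic_at_i_infinity f" "holomorphic_at_i_infinity g"
  obtains h F G where "h > 0" "F holomorphic_on ball 0 1" "G holomorphic_on ball 0 1"
    "\<And>z. Im z > 0 \<Longrightarrow> f z = F (exp (2 * of_real pi * \<i> * z / of_nat h))"
    "\<And>z. Im z > 0 \<Longrightarrow> g z = G (exp (2 * of_real pi * \<i> * z / of_nat h))"
proof -
  from assms(1) obtain h F where F: "h > 0" "F holomorphic_on ball 0 1"
    "\<And>z. Im z > 0 \<Longrightarrow> f z = F (exp (2 * of_real pi * \<i> * z / of_nat h))"
    unfolding holomorphic_at_i_infinity_def by auto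
  from assms(2) obtain h' G where G: "h' > 0" "G holomorphic_on ball 0 1"
    "\<And>z. Im z > 0 \<Longrightarrow> g z = G (exp (2 * of_real pi * \<i> * z / of_nat h'))"
    unfolding holomorphic_at_i_infinity_def by auto
  show ?thesis
  proof (rule that[of "h * h'" "\<lambda>w. F (1 * w ^ h')" "\<lambda>w. G (1 * w ^ h)"])
    show "(\<lambda>w. F (1 * w ^ h')) holomorphic_on ball 0 1" "(\<lambda>w. G (1 * w ^ h)) holomorphic_on ball 0 1"
      using F G by (intro holomorphic_compose_power; simp)+
    show "f z = F (1 * exp (2 * of_real pi * \<i> * z / of_nat (h * h')) ^ h')"
      "g z = G (1 * exp (2 * of_real pi * \<i> * z / of_nat (h * h')) ^ h)" if "Im z > 0" for z
      using F(3)[OF that] G(3)[OF that] exp_divide_power[OF F(1) G(1), of z] exp_divide_power[OF G(1) F(1), of z]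
      by (simp_all only: mult.commute[of h h'] mult_1_left)
  qed (use F G in simp)
qed

lemma holomorphic_at_i_infinityI:
  assumes "h > 0" "F holomorphic_on ball 0 1"
    "\<And>z. Im z > 0 \<Longrightarrow> f z = F (exp (2 * of_real pi * \<i> * z / of_nat h))"
  shows "holomorphic_at_i_infinity f"
  unfolding holomorphic_at_i_infinity_def using assms by auto

lemma holomorphic_at_i_infinityE:
  assumes "holomorphic_at_i_infinity f"
  obtains h F where "h > 0" "F holomorphic_on ball 0 1"
    "\<And>z. Im z > 0 \<Longrightarrow> f z = F (exp (2 * of_real pi * \<i> * z / of_nat h))"
  using assms unfolding holomorphic_at_i_infinity_def by auto

lemma holomorphic_at_i_infinity_diff:
  assumes "holomorphic_at_i_infinity f" "holomorphic_at_i_infinity g"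
  shows "holomorphic_at_i_infinity (\<lambda>z. f z - g z)"
proof -
  obtain h F G where *: "h > 0" "F holomorphic_on ball 0 1" "G holomorphic_on ball 0 1"
    "\<And>z. Im z > 0 \<Longrightarrow> f z = F (exp (2 * of_real pi * \<i> * z / of_nat h))"
    "\<And>z. Im z > 0 \<Longrightarrow> g z = G (exp (2 * of_real pi * \<i> * z / of_nat h))"
    using holomorphic_at_i_infinity_common[OF assms] by blast
  show ?thesis
    by (rule holomorphic_at_i_infinityI[of h "\<lambda>w. F w - G w"]) (use * in \<open>auto intro!: holomorphic_intros\<close>)
qed

lemma holomorphic_at_i_infinity_mult:
  assumes "holomorphic_at_i_infinity f" "holomorphic_at_i_infinity g"
  shows "holomorphic_at_i_infinity (\<lambda>z. f z * g z)"
proof -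
  obtain h F G where *: "h > 0" "F holomorphic_on ball 0 1" "G holomorphic_on ball 0 1"
    "\<And>z. Im z > 0 \<Longrightarrow> f z = F (exp (2 * of_real pi * \<i> * z / of_nat h))"
    "\<And>z. Im z > 0 \<Longrightarrow> g z = G (exp (2 * of_real pi * \<i> * z / of_nat h))"
    using holomorphic_at_i_infinity_common[OF assms] by blast
  show ?thesis
    by (rule holomorphic_at_i_infinityI[of h "\<lambda>w. F w * G w"]) (use * in \<open>auto intro!: holomorphic_intros\<close>)
qed

lemma holomorphic_at_i_infinity_const: "holomorphic_at_i_infinity (\<lambda>_. c)"
  by (rule holomorphic_at_i_infinityI[of 1 "\<lambda>_. c"]) auto

lemma holomorphic_at_i_infinity_add:
  assumes "holomorphic_at_i_infinity f" "holomorphic_at_i_infinity g"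
  shows "holomorphic_at_i_infinity (\<lambda>z. f z + g z)"
  using holomorphic_at_i_infinity_diff[OF assms(1)
      holomorphic_at_i_infinity_mult[OF holomorphic_at_i_infinity_const[of "- 1"] assms(2)]]
  by simp

lemma has_field_derivative_exp_coordinate:
  assumes "F holomorphic_on ball 0 1" "Im z > 0" "h > 0"
  shows "((\<lambda>z. F (exp (2 * of_real pi * \<i> * z / of_nat h))) has_field_derivative
      deriv F (exp (2 * of_real pi * \<i> * z / of_nat h)) *
        (2 * of_real pi * \<i> / of_nat h * exp (2 * of_real pi * \<i> * z / of_nat h))) (at z)"
proof (rule DERIV_chain2[where f = F])
  show "(F has_field_derivative deriv F (exp (2 * of_real pi * \<i> * z / of_nat h)))
      (at (exp (2 * of_real pi * \<i> * z / of_nat h)))"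
    by (rule holomorphic_derivI[OF assms(1) _ exp_in_unit_ball[OF assms(2,3)]]) simp
qed (use assms in \<open>auto intro!: derivative_eq_intros\<close>)

lemma deriv_cong_upper_half_plane:
  assumes "\<And>z. Im z > 0 \<Longrightarrow> f z = g z" "Im z > 0"
  shows "deriv f z = deriv g z"
proof (rule deriv_cong_ev)
  have "\<forall>\<^sub>F z in nhds z. z \<in> upper_half_plane"
    using assms(2) by (intro eventually_nhds_in_open open_upper_half_plane) simp
  then show "\<forall>\<^sub>F z in nhds z. f z = g z"
    by eventually_elim (use assms(1) in simp)
qed simp

text \<open>In the coordinate w of width \<open>h\<close>, d/dz is (2 pi i / h) w d/dw, which
  preserves holomorphy on the disc.\<close>

lemma holomorphic_at_i_infinity_deriv:
  assumes "holomorphic_at_i_infinity f"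
  shows "holomorphic_at_i_infinity (deriv f)"
proof -
  obtain h F where *: "h > 0" "F holomorphic_on ball 0 1"
    "\<And>z. Im z > 0 \<Longrightarrow> f z = F (exp (2 * of_real pi * \<i> * z / of_nat h))"
    using holomorphic_at_i_infinityE[OF assms] by blast
  show ?thesis
  proof (rule holomorphic_at_i_infinityI[OF *(1), of "\<lambda>w. deriv F w * (2 * of_real pi * \<i> / of_nat h * w)"])
    show "(\<lambda>w. deriv F w * (2 * of_real pi * \<i> / of_nat h * w)) holomorphic_on ball 0 1"
      using *(2) by (intro holomorphic_intros) auto
    fix z :: complex assume z: "Im z > 0"
    have "deriv f z = deriv (\<lambda>z. F (exp (2 * of_real pi * \<i> * z / of_nat h))) z"
      by (rule deriv_cong_upper_half_plane[OF *(3) z])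
    also have "\<dots> = deriv F (exp (2 * of_real pi * \<i> * z / of_nat h)) *
        (2 * of_real pi * \<i> / of_nat h * exp (2 * of_real pi * \<i> * z / of_nat h))"
      by (rule DERIV_imp_deriv[OF has_field_derivative_exp_coordinate[OF *(2) z *(1)]])
    finally show "deriv f z = deriv F (exp (2 * of_real pi * \<i> * z / of_nat h)) *
        (2 * of_real pi * \<i> / of_nat h * exp (2 * of_real pi * \<i> * z / of_nat h))" .
  qed
qed

lemma holomorphic_at_i_infinity_imp_holomorphic:
  assumes "holomorphic_at_i_infinity f"
  shows "f holomorphic_on upper_half_plane"
proof -
  obtain h F where *: "h > 0" "F holomorphic_on ball 0 1"
    "\<And>z. Im z > 0 \<Longrightarrow> f z = F (exp (2 * of_real pi * \<i> * z / of_nat h))"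
    using holomorphic_at_i_infinityE[OF assms] by blast
  have "(\<lambda>z. F (exp (2 * of_real pi * \<i> * z / of_nat h))) holomorphic_on upper_half_plane"
    unfolding holomorphic_on_open[OF open_upper_half_plane]
    using has_field_derivative_exp_coordinate[OF *(2) _ *(1)] in_upper_half_plane by blast
  then show ?thesis
    by (rule holomorphic_transform) (use *(3) in simp)
qed

lemma holomorphic_at_i_infinity_affine:
  assumes "holomorphic_at_i_infinity f" "p > 0" "r > 0"
  shows "holomorphic_at_i_infinity (\<lambda>z. f ((of_int p * z + of_int q) / of_int r))"
proof -
  obtain h F where *: "h > 0" "F holomorphic_on ball 0 1"
    "\<And>z. Im z > 0 \<Longrightarrow> f z = F (exp (2 * of_real pi * \<i> * z / of_nat h))"
    using holomorphic_at_i_infinityE[OF assms(1)] by blast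
  define u :: complex where "u = exp (2 * of_real pi * \<i> * of_int q / of_nat (h * nat r))"
  show ?thesis
  proof (rule holomorphic_at_i_infinityI[of "h * nat r" "\<lambda>w. F (u * w ^ nat p)"])
    show "h * nat r > 0"
      using * assms by simp
    show "(\<lambda>w. F (u * w ^ nat p)) holomorphic_on ball 0 1"
      using assms * by (intro holomorphic_compose_power) (auto simp: u_def)
    fix z :: complex assume z: "Im z > 0"
    have [simp]: "of_nat (nat r) = (of_int r :: complex)" "of_nat (nat p) = (of_int p :: complex)"
      using assms by (auto simp: of_nat_nat)
    have "Im (w / of_int r) = Im w / of_int r" for w
      using Im_divide_of_real[of w "of_int r"] by simp
    then have "Im ((of_int p * z + of_int q) / of_int r) > 0"
      using z assms by simp
    from *(3)[OF this] have "f ((of_int p * z + of_int q) / of_int r) =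
        F (exp (2 * of_real pi * \<i> * ((of_int p * z + of_int q) / of_int r) / of_nat h))" .
    also have "exp (2 * of_real pi * \<i> * ((of_int p * z + of_int q) / of_int r) / of_nat h) =
        u * exp (2 * of_real pi * \<i> * z / of_nat (h * nat r)) ^ nat p"
    proof -
      have "X * ((P * z + Q) / R) / H = X * Q / (H * R) + P * (X * z / (H * R))" for X P Q R H :: complex
        by (simp add: add_divide_distrib distrib_left mult_ac)
      then show ?thesis
        unfolding u_def exp_of_nat_mult[symmetric] exp_add[symmetric] by simp
    qed
    finally show "f ((of_int p * z + of_int q) / of_int r) =
        F (u * exp (2 * of_real pi * \<i> * z / of_nat (h * nat r)) ^ nat p)" .
  qed
qed

lemma holomorphic_at_i_infinity_eval_fps:
  assumes "fps_conv_radius F \<ge> 1"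
  shows "holomorphic_at_i_infinity (\<lambda>z. eval_fps F (nome z))"
proof (rule holomorphic_at_i_infinityI[of 1 "eval_fps F"])
  show "eval_fps F holomorphic_on ball 0 1"
    using less_conv_radiusI[OF assms] by (intro holomorphic_on_eval_fps) auto
qed (simp_all add: nome_def)

lemma holomorphic_at_i_infinity_eis: "k \<ge> 2 \<Longrightarrow> holomorphic_at_i_infinity (eis k)"
  using holomorphic_at_i_infinity_eval_fps[OF conv_radius_eis_fps, of k] by (simp add: eis_def[abs_def])

text \<open>The parameter \<open>s\<close> is the quasimodular constant of \<open>f\<close>. For
  \<open>s = 0\<close> this is, up to sign, the first Rankin-Cohen bracket in weights 2 and
  \<open>k\<close>.\<close>

definition rc_bracket :: "nat \<Rightarrow> complex \<Rightarrow> (complex \<Rightarrow> complex) \<Rightarrow> (complex \<Rightarrow> complex) \<Rightarrow> complex \<Rightarrow> complex" where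
  "rc_bracket k s f g z = of_nat k * deriv f z * g z - 2 * f z * deriv g z + s / of_nat (k + 1) * deriv (deriv g) z"

lemma holomorphic_at_i_infinity_rc_bracket:
  assumes "holomorphic_at_i_infinity f" "holomorphic_at_i_infinity g"
  shows "holomorphic_at_i_infinity (rc_bracket k s f g)"
  unfolding rc_bracket_def [abs_def]
  by (intro holomorphic_at_i_infinity_add holomorphic_at_i_infinity_diff holomorphic_at_i_infinity_mult
      holomorphic_at_i_infinity_const holomorphic_at_i_infinity_deriv assms)

text \<open>Chain rule: the derivative of the Moebius map is 1/(c z + d)^2 because the determinant
  is 1.\<close>

lemma deriv_moebius:
  fixes a b c d :: int
  assumes det: "a * d - b * c = 1" and z: "Im z > 0"
    and hol: "f holomorphic_on upper_half_plane"
    and eq: "\<And>z. Im z > 0 \<Longrightarrow> f ((of_int a * z + of_int b) / (of_int c * z + of_int d)) = g z"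
    and der: "(g has_field_derivative g') (at z)"
  shows "deriv f ((of_int a * z + of_int b) / (of_int c * z + of_int d)) = (of_int c * z + of_int d) ^ 2 * g'"
proof -
  define M where "M = (\<lambda>z::complex. (of_int a * z + of_int b) / (of_int c * z + of_int d))"
  note uni = lat_unimodular[OF det z]
  have "of_int a * of_int d - of_int b * of_int c = (1 :: complex)"
    using arg_cong[OF det, of "of_int :: int \<Rightarrow> complex"] by simp
  then have num: "of_int a * (of_int c * z + of_int d) - (of_int a * z + of_int b) * of_int c = (1 :: complex)"
    by (simp add: algebra_simps)
  have "(M has_field_derivative ((of_int a * (of_int c * z + of_int d) - (of_int a * z + of_int b) * of_int c) /
      ((of_int c * z + of_int d) * (of_int c * z + of_int d)))) (at z)"
    unfolding M_def by (rule derivative_eq_intros refl uni(1) | simp)+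
  then have M: "(M has_field_derivative 1 / (of_int c * z + of_int d) ^ 2) (at z)"
    unfolding num by (simp add: power2_eq_square)
  have "((\<lambda>z. f (M z)) has_field_derivative deriv f (M z) * (1 / (of_int c * z + of_int d) ^ 2)) (at z)"
  proof (rule DERIV_chain2[where f = f, OF _ M])
    show "(f has_field_derivative deriv f (M z)) (at (M z))"
      by (rule holomorphic_derivI[OF hol open_upper_half_plane]) (use uni(4) in \<open>simp add: M_def\<close>)
  qed
  moreover have "((\<lambda>z. f (M z)) has_field_derivative g') (at z)"
  proof (rule DERIV_cong_ev[THEN iffD2, OF refl _ refl der])
    have "\<forall>\<^sub>F z in nhds z. z \<in> upper_half_plane"
      using z by (intro eventually_nhds_in_open open_upper_half_plane) simp
    then show "\<forall>\<^sub>F z in nhds z. f (M z) = g z"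
      by eventually_elim (use eq in \<open>simp add: M_def\<close>)
  qed
  ultimately have "deriv f (M z) * (1 / (of_int c * z + of_int d) ^ 2) = g'"
    by (rule DERIV_unique)
  then show ?thesis
    using uni(1) by (simp add: M_def field_simps)
qed

text \<open>The functions on the right may differ from those on the left, so that the lemma covers
  expansions at all cusps as well as invariance. Three kinds of extra terms cancel:
  \<open>f1 g1\<close> has the factor 2 k - 2 k, \<open>g1'\<close> the factor -2 s + (k + (k + 2))
  s / (k + 1), and \<open>g1\<close> the factor k s - 2 k s + k (k + 1) s / (k + 1). The last two
  dictate the coefficient s / (k + 1) of \<open>g''\<close>.\<close>

lemma rc_bracket_moebius:
  fixes a b c d :: int
  assumes det: "a * d - b * c = 1" and z: "Im z > 0"
    and hol: "f holomorphic_on upper_half_plane" "g holomorphic_on upper_half_plane"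
      "f1 holomorphic_on upper_half_plane" "g1 holomorphic_on upper_half_plane"
    and f: "\<And>z. Im z > 0 \<Longrightarrow> f ((of_int a * z + of_int b) / (of_int c * z + of_int d)) =
      (of_int c * z + of_int d) ^ 2 * f1 z + s * of_int c * (of_int c * z + of_int d)"
    and g: "\<And>z. Im z > 0 \<Longrightarrow> g ((of_int a * z + of_int b) / (of_int c * z + of_int d)) =
      (of_int c * z + of_int d) ^ k * g1 z"
    and k: "k > 0"
  shows "rc_bracket k s f g ((of_int a * z + of_int b) / (of_int c * z + of_int d)) =
    (of_int c * z + of_int d) ^ (k + 4) * rc_bracket k s f1 g1 z"
proof -
  define C :: complex where "C = of_int c"
  define j where "j = (\<lambda>z::complex. C * z + of_int d)"
  define M where "M = (\<lambda>z::complex. (of_int a * z + of_int b) / (of_int c * z + of_int d))"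
  have der: "(h has_field_derivative deriv h z) (at z)" if "h holomorphic_on upper_half_plane" "Im z > 0" for h z
    using holomorphic_derivI[OF that(1) open_upper_half_plane] that(2) by simp
  have hol': "deriv h holomorphic_on upper_half_plane" if "h holomorphic_on upper_half_plane" for h
    by (intro holomorphic_deriv that open_upper_half_plane)
  have pk: "j z * j z ^ (k - 1) = j z ^ k" for z
    using k by (cases k) auto
  have dj: "((\<lambda>z. j z ^ n) has_field_derivative of_nat n * j z ^ (n - 1) * C) (at z)" for n z
    unfolding j_def by (auto intro!: derivative_eq_intros)
  have dmult: "((\<lambda>z. e * j z ^ n * h z) has_field_derivative
      e * of_nat n * j z ^ (n - 1) * C * h z + deriv h z * (e * j z ^ n)) (at z)"
    if "h holomorphic_on upper_half_plane" "Im z > 0" for e h n z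
    using DERIV_mult[OF DERIV_cmult[OF dj[of n z], of e] der[OF that]] by (simp only: mult.assoc)
  have f': "f (M z) = 1 * j z ^ 2 * f1 z + (s * C) * j z ^ 1" if "Im z > 0" for z
    using f[OF that] by (simp add: M_def j_def C_def)
  have g': "g (M z) = 1 * j z ^ k * g1 z" if "Im z > 0" for z
    using g[OF that] by (simp add: M_def j_def C_def)
  have rule: "deriv h (M z) = j z ^ 2 * g'"
    if "Im z > 0" "h holomorphic_on upper_half_plane" "\<And>z. Im z > 0 \<Longrightarrow> h (M z) = g2 z"
      "(g2 has_field_derivative g') (at z)" for h g2 g' z
    unfolding M_def j_def C_def
    by (rule deriv_moebius[OF det that(1,2) _ that(4)]) (use that(3) in \<open>simp add: M_def\<close>)
  have "deriv f (M z) = j z ^ 2 * (1 * of_nat 2 * j z ^ (2 - 1) * C * f1 z + deriv f1 z * (1 * j z ^ 2)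
      + (s * C) * (of_nat 1 * j z ^ (1 - 1) * C))"
    by (rule rule[OF z hol(1) f' DERIV_add[OF dmult[OF hol(3) z] DERIV_cmult[OF dj]]])
  then have 1: "deriv f (M z) = j z ^ 2 * (2 * C * j z * f1 z + j z ^ 2 * deriv f1 z + s * C ^ 2)"
    by (simp add: power2_eq_square mult_ac)
  have 2: "deriv g (M z) = of_nat k * C * j z ^ (k + 1) * g1 z + 1 * j z ^ (k + 2) * deriv g1 z" if "Im z > 0" for z
  proof -
    have "deriv g (M z) = j z ^ 2 * (1 * of_nat k * j z ^ (k - 1) * C * g1 z + deriv g1 z * (1 * j z ^ k))"
      by (rule rule[OF that hol(2) g' dmult[OF hol(4) that]])
    also have "\<dots> = of_nat k * C * (j z * (j z * j z ^ (k - 1))) * g1 z + j z ^ (k + 2) * deriv g1 z"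
      by (simp add: power2_eq_square ring_distribs mult_ac)
    finally show ?thesis
      unfolding pk by simp
  qed
  have "deriv (deriv g) (M z) = j z ^ 2 *
      ((of_nat k * C) * of_nat (k + 1) * j z ^ (k + 1 - 1) * C * g1 z + deriv g1 z * ((of_nat k * C) * j z ^ (k + 1))
      + (1 * of_nat (k + 2) * j z ^ (k + 2 - 1) * C * deriv g1 z + deriv (deriv g1) z * (1 * j z ^ (k + 2))))"
    by (rule rule[OF z hol'[OF hol(2)] 2 DERIV_add[OF dmult[OF hol(4) z] dmult[OF hol'[OF hol(4)] z]]])
  then have 3: "deriv (deriv g) (M z) = j z ^ 2 * (of_nat k * C * (of_nat (k + 1) * j z ^ k * C * g1 z + j z ^ (k + 1) * deriv g1 z)
      + (of_nat (k + 2) * j z ^ (k + 1) * C * deriv g1 z + j z ^ (k + 2) * deriv (deriv g1) z))"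
    by (simp add: ring_distribs mult_ac)
  \<comment> \<open>Written with \<open>t\<close> instead of \<open>s\<close>, and with
    \<open>j z ^ k\<close> abstracted to \<open>P\<close>, the claim becomes a polynomial identity
    without division.\<close>
  define t where "t = s / of_nat (k + 1)"
  have s: "s = t * (of_nat k + 1)"
    using of_nat_neq_0[of k, where 'a = complex] by (simp add: t_def add.commute)
  have alg: "K * (J ^ 2 * (2 * C * J * f0 + J ^ 2 * f0' + t * (K + 1) * C ^ 2)) * (P * g0)
      - 2 * (J ^ 2 * f0 + t * (K + 1) * C * J) * (K * C * (P * J) * g0 + P * J ^ 2 * g0')
      + t * (J ^ 2 * (K * C * ((K + 1) * P * C * g0 + P * J * g0') + ((K + 2) * (P * J) * C * g0' + P * J ^ 2 * g0'')))
      = P * J ^ 4 * (K * f0' * g0 - 2 * f0 * g0' + t * g0'')"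
    for K J P f0 f0' g0 g0' g0'' :: complex
    by (simp add: algebra_simps power2_eq_square power4_eq_xxxx)
  have "rc_bracket k s f g (M z) = j z ^ (k + 4) * rc_bracket k s f1 g1 z"
    unfolding rc_bracket_def 1 2[OF z] 3 f'[OF z] g'[OF z] t_def[symmetric]
    using alg[of "of_nat k" "j z" "f1 z" "deriv f1 z" "j z ^ k" "g1 z" "deriv g1 z" "deriv (deriv g1) z"]
    by (simp add: s power_add power2_eq_square power4_eq_xxxx mult_ac add_ac)
  then show ?thesis
    by (simp add: M_def j_def C_def)
qed

section \<open>Modularity of the bracket of Eisenstein series\<close>

text \<open>
  In terms of matrices, \<open>diag(N, 1) A = A' B\<close> with \<open>A'\<close> in \<open>SL\<^sub>2(\<int>)\<close> and \<open>B\<close> upper triangular with rows \<open>(p, q)\<close>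
  and \<open>(0, r)\<close>. This describes \<open>G\<^sub>k(N z)\<close> at every cusp.
\<close>

lemma hermite_decomposition:
  fixes N a b c d :: int
  assumes det: "a * d - b * c = 1" and "N > 0"
  obtains p q r a' b' c' d' where "p > 0" "r > 0" "p * r = N" "a' * d' - b' * c' = 1"
    "N * a = a' * p" "N * b = a' * q + b' * r" "c = c' * p" "d = c' * q + d' * r"
proof -
  define p where "p = gcd (N * a) c"
  have "N * a \<noteq> 0 \<or> c \<noteq> 0"
    using det \<open>N > 0\<close> by (cases "a = 0") auto
  then have p: "p > 0"
    by (auto simp: p_def)
  obtain a' c' where ac: "N * a = a' * p" "c = c' * p"
    unfolding p_def by (metis dvdE gcd_dvd1 gcd_dvd2 mult.commute)
  obtain u v where "u * (N * a) + v * c = p"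
    unfolding p_def using bezout_int by blast
  then have "(u * a' + v * c') * p = 1 * p"
    unfolding ac by (simp add: algebra_simps)
  then have uv: "u * a' + v * c' = 1"
    using p by simp
  \<comment> \<open>Bezout completes the primitive column (a', c') to the unimodular A' with second
    column (-v, u). The pair (q, r) is the inverse of A' applied to the second column of diag(N, 1)
    A.\<close>
  define q r where "q = u * (N * b) + v * d" and "r = a' * d - c' * (N * b)"
  have "p * r = (a' * p) * d - (c' * p) * (N * b)"
    by (simp add: r_def algebra_simps)
  also have "\<dots> = N * (a * d - b * c)"
    unfolding ac[symmetric] by (simp add: algebra_simps)
  finally have pr: "p * r = N"
    using det by simp
  have "a' * q + (- v) * r = (u * a' + v * c') * (N * b)"
    by (simp add: q_def r_def algebra_simps)
  moreover have "c' * q + u * r = (u * a' + v * c') * d"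
    by (simp add: q_def r_def algebra_simps)
  ultimately show ?thesis
  proof (intro that[of p r a' u "- v" c' q])
    show "r > 0"
      using pr p \<open>N > 0\<close> by (metis zero_less_mult_pos)
    show "a' * u - - v * c' = 1"
      using uv by (simp add: mult.commute)
  qed (use uv pr p ac in simp_all)
qed

text \<open>The matrix identity read as an action on the half plane, together with the cocycle
  relation; the triangular factor has automorphy factor \<open>r\<close>.\<close>

lemma hermite_moebius:
  fixes N a b c d p q r a' b' c' d' :: int
  assumes "r > 0" "p > 0"
    and rel: "N * a = a' * p" "N * b = a' * q + b' * r" "c = c' * p" "d = c' * q + d' * r"
  defines "w \<equiv> \<lambda>z. (of_int p * z + of_int q) / of_int r :: complex"
  shows "of_int N * ((of_int a * z + of_int b) / (of_int c * z + of_int d)) =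
      (of_int a' * w z + of_int b') / (of_int c' * w z + of_int d')"
    and "of_int c' * w z + of_int d' = (of_int c * z + of_int d) / of_int r"
    and "Im z > 0 \<Longrightarrow> Im (w z) > 0"
proof -
  have r: "of_int r \<noteq> (0 :: complex)"
    using assms by simp
  have rel': "of_int N * of_int a = (of_int a' * of_int p :: complex)"
    "of_int N * of_int b = (of_int a' * of_int q + of_int b' * of_int r :: complex)"
    using rel(1,2) by (metis of_int_mult, metis of_int_mult of_int_add)
  show j: "of_int c' * w z + of_int d' = (of_int c * z + of_int d) / of_int r"
    using r by (simp add: w_def rel(3,4) field_simps)
  have n: "of_int a' * w z + of_int b' = of_int N * (of_int a * z + of_int b) / of_int r"
  proof -
    have "of_int N * (of_int a * z + of_int b) = (of_int N * of_int a) * z + of_int N * of_int b"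
      by (simp add: algebra_simps)
    then show ?thesis
      unfolding rel' using r by (simp add: w_def field_simps)
  qed
  show "of_int N * ((of_int a * z + of_int b) / (of_int c * z + of_int d)) =
      (of_int a' * w z + of_int b') / (of_int c' * w z + of_int d')"
    unfolding n j using r by simp
  have "Im (u / of_int r) = Im u / of_int r" for u
    using Im_divide_of_real[of u "of_int r"] by simp
  then show "Im (w z) > 0" if "Im z > 0"
    using that assms by (simp add: w_def)
qed

text \<open>In weight 2 the correction contains c' (c z + d) / r with c' = c / p, and
  \<open>p * r = N\<close> makes it c (c z + d) / N. The quasimodular constant is thus independent
  of the decomposition, hence of the cusp.\<close>

lemma eis_hermite:
  fixes N a b c d p q r a' b' c' d' :: int
  assumes "p > 0" "r > 0" "p * r = N" and det: "a' * d' - b' * c' = 1"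
    and rel: "N * a = a' * p" "N * b = a' * q + b' * r" "c = c' * p" "d = c' * q + d' * r"
    and z: "Im z > 0"
  shows "even k \<Longrightarrow> k \<ge> 4 \<Longrightarrow> eis k (of_int N * ((of_int a * z + of_int b) / (of_int c * z + of_int d))) =
      (of_int c * z + of_int d) ^ k * (eis k ((of_int p * z + of_int q) / of_int r) / of_int r ^ k)"
    and "eis 2 (of_int N * ((of_int a * z + of_int b) / (of_int c * z + of_int d))) =
      (of_int c * z + of_int d) ^ 2 * (eis 2 ((of_int p * z + of_int q) / of_int r) / of_int r ^ 2) +
      (- 1 / (4 * of_real pi * \<i> * of_int N)) * of_int c * (of_int c * z + of_int d)"
proof -
  note h = hermite_moebius[OF assms(2,1) rel, of z]
  show "eis k (of_int N * ((of_int a * z + of_int b) / (of_int c * z + of_int d))) =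
      (of_int c * z + of_int d) ^ k * (eis k ((of_int p * z + of_int q) / of_int r) / of_int r ^ k)"
    if "even k" "k \<ge> 4"
    unfolding h(1) eis_modular[OF det h(3)[OF z] that] unfolding h(2) by (simp add: power_divide)
  have "of_int N = (of_int p * of_int r :: complex)"
    using \<open>p * r = N\<close> by auto
  then show "eis 2 (of_int N * ((of_int a * z + of_int b) / (of_int c * z + of_int d))) =
      (of_int c * z + of_int d) ^ 2 * (eis 2 ((of_int p * z + of_int q) / of_int r) / of_int r ^ 2) +
      (- 1 / (4 * of_real pi * \<i> * of_int N)) * of_int c * (of_int c * z + of_int d)"
    unfolding h(1) eis_2_modular[OF det h(3)[OF z]] unfolding h(2)
    using assms(1,2) by (simp add: rel(3) power_divide divide_simps)
qed

text \<open>The value 0 off the half plane is the convention of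
  \<open>modular_forms\<close>.\<close>

definition eis_form :: "nat \<Rightarrow> nat \<Rightarrow> nat \<Rightarrow> complex \<Rightarrow> complex" where
  "eis_form k a b z = (if Im z > 0 then
     rc_bracket k (- 1 / (4 * of_real pi * \<i> * of_nat a)) (\<lambda>z. eis 2 (of_nat a * z)) (\<lambda>z. eis k (of_nat b * z)) z else 0)"

lemma holomorphic_at_i_infinity_eis_affine:
  assumes "k \<ge> 2" "p > 0" "r > 0"
  shows "holomorphic_at_i_infinity (\<lambda>z. eis k ((of_int p * z + of_int q) / of_int r) / of_int r ^ n)"
  using holomorphic_at_i_infinity_mult[OF
      holomorphic_at_i_infinity_affine[OF holomorphic_at_i_infinity_eis[OF assms(1)] assms(2,3), of q]
      holomorphic_at_i_infinity_const[of "1 / of_int r ^ n"]]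
  by simp

text \<open>Used twice: with Hermite decompositions of an arbitrary matrix for holomorphy at the
  cusps, and with diagonal triangular factors for invariance under
  \<open>Gamma0 (a * b)\<close>.\<close>

lemma eis_form_slash:
  fixes \<alpha> \<beta> \<gamma> \<delta> p q r a' b' c' d' p1 q1 r1 a1 b1 c1 d1 :: int
  assumes det: "\<alpha> * \<delta> - \<beta> * \<gamma> = 1" and k: "even k" "k \<ge> 4" and ab: "a > 0" "b > 0"
    and H: "p > 0" "r > 0" "p * r = int a" "a' * d' - b' * c' = 1"
      "int a * \<alpha> = a' * p" "int a * \<beta> = a' * q + b' * r" "\<gamma> = c' * p" "\<delta> = c' * q + d' * r"
    and H1: "p1 > 0" "r1 > 0" "p1 * r1 = int b" "a1 * d1 - b1 * c1 = 1"
      "int b * \<alpha> = a1 * p1" "int b * \<beta> = a1 * q1 + b1 * r1" "\<gamma> = c1 * p1" "\<delta> = c1 * q1 + d1 * r1"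
    and z: "Im z > 0"
  shows "eis_form k a b ((of_int \<alpha> * z + of_int \<beta>) / (of_int \<gamma> * z + of_int \<delta>)) / (of_int \<gamma> * z + of_int \<delta>) ^ (k + 4) = rc_bracket k (- 1 / (4 * of_real pi * \<i> * of_nat a))
    (\<lambda>z. eis 2 ((of_int p * z + of_int q) / of_int r) / of_int r ^ 2)
    (\<lambda>z. eis k ((of_int p1 * z + of_int q1) / of_int r1) / of_int r1 ^ k) z"
proof -
  note uni = lat_unimodular[OF det z]
  have hol: "(\<lambda>z. eis k (of_nat N * z)) holomorphic_on upper_half_plane" if "N > 0" "k \<ge> 2" for N k
    using holomorphic_at_i_infinity_imp_holomorphic[OF holomorphic_at_i_infinity_eis_affine[OF that(2), of "int N" 1 0 0]] that
    by simp
  have hol': "(\<lambda>z. eis k ((of_int p * z + of_int q) / of_int r) / of_int r ^ n) holomorphic_on upper_half_plane"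
    if "p > 0" "r > 0" "k \<ge> 2" for k p q r n
    by (intro holomorphic_at_i_infinity_imp_holomorphic holomorphic_at_i_infinity_eis_affine that)
  have "rc_bracket k (- 1 / (4 * of_real pi * \<i> * of_nat a)) (\<lambda>z. eis 2 (of_nat a * z)) (\<lambda>z. eis k (of_nat b * z))
      ((of_int \<alpha> * z + of_int \<beta>) / (of_int \<gamma> * z + of_int \<delta>)) =
    (of_int \<gamma> * z + of_int \<delta>) ^ (k + 4) *
    rc_bracket k (- 1 / (4 * of_real pi * \<i> * of_nat a))
    (\<lambda>z. eis 2 ((of_int p * z + of_int q) / of_int r) / of_int r ^ 2)
    (\<lambda>z. eis k ((of_int p1 * z + of_int q1) / of_int r1) / of_int r1 ^ k) z"
  proof (rule rc_bracket_moebius[OF det z])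
    fix z :: complex assume z: "Im z > 0"
    show "eis 2 (of_nat a * ((of_int \<alpha> * z + of_int \<beta>) / (of_int \<gamma> * z + of_int \<delta>))) =
      (of_int \<gamma> * z + of_int \<delta>) ^ 2 * (eis 2 ((of_int p * z + of_int q) / of_int r) / of_int r ^ 2) +
      (- 1 / (4 * of_real pi * \<i> * of_nat a)) * of_int \<gamma> * (of_int \<gamma> * z + of_int \<delta>)"
      using eis_hermite(2)[OF H z] by (simp only: of_int_of_nat_eq)
    show "eis k (of_nat b * ((of_int \<alpha> * z + of_int \<beta>) / (of_int \<gamma> * z + of_int \<delta>))) =
      (of_int \<gamma> * z + of_int \<delta>) ^ k * (eis k ((of_int p1 * z + of_int q1) / of_int r1) / of_int r1 ^ k)"
      using eis_hermite(1)[OF H1 z k] by (simp only: of_int_of_nat_eq)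
  qed (use k ab H(1,2) H1(1,2) in \<open>auto intro!: hol hol'\<close>)
  then show ?thesis
    using uni(1,4) by (simp add: eis_form_def)
qed

lemma eis_form_modular:
  assumes k: "even k" "k \<ge> 4" and ab: "a > 0" "b > 0"
  shows "eis_form k a b \<in> modular_forms (k + 4) (a * b)"
proof -
  have inf: "holomorphic_at_i_infinity (slash (k + 4) A (eis_form k a b))" if A: "A \<in> SL2Z" for A
  proof -
    define \<alpha> \<beta> \<gamma> \<delta> where e: "\<alpha> = (A :: int ^ 2 ^ 2) $ 1 $ 1" "\<beta> = A $ 1 $ 2" "\<gamma> = A $ 2 $ 1" "\<delta> = A $ 2 $ 2"
    have det: "\<alpha> * \<delta> - \<beta> * \<gamma> = 1"
      using A by (simp add: SL2Z_def det_2 e)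
    have "int a > 0" "int b > 0"
      using ab by simp_all
    from this(1) obtain p q r a' b' c' d' where H: "p > 0" "r > 0" "p * r = int a" "a' * d' - b' * c' = 1"
      "int a * \<alpha> = a' * p" "int a * \<beta> = a' * q + b' * r" "\<gamma> = c' * p" "\<delta> = c' * q + d' * r"
      by (rule hermite_decomposition[OF det])
    from \<open>int b > 0\<close> obtain p1 q1 r1 a1 b1 c1 d1 where H1: "p1 > 0" "r1 > 0" "p1 * r1 = int b" "a1 * d1 - b1 * c1 = 1"
      "int b * \<alpha> = a1 * p1" "int b * \<beta> = a1 * q1 + b1 * r1" "\<gamma> = c1 * p1" "\<delta> = c1 * q1 + d1 * r1"
      by (rule hermite_decomposition[OF det])
    show ?thesis
      unfolding slash_def [abs_def] e[symmetric]
      by (rule holomorphic_at_i_infinity_cong[THEN iffD2, OF eis_form_slash[OF det k ab H H1]], assumption)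
        (intro holomorphic_at_i_infinity_rc_bracket holomorphic_at_i_infinity_eis_affine H H1; use k in simp)
  qed
  have inv: "slash (k + 4) A (eis_form k a b) z = eis_form k a b z" if A: "A \<in> Gamma0 (a * b)" and z: "Im z > 0" for A z
  proof -
    define \<alpha> \<beta> \<gamma> \<delta> where e: "\<alpha> = (A :: int ^ 2 ^ 2) $ 1 $ 1" "\<beta> = A $ 1 $ 2" "\<gamma> = A $ 2 $ 1" "\<delta> = A $ 2 $ 2"
    have det: "\<alpha> * \<delta> - \<beta> * \<gamma> = 1" and dvd: "int (a * b) dvd \<gamma>"
      using A by (auto simp: Gamma0_def SL2Z_def det_2 e)
    \<comment> \<open>For \<open>N\<close> dividing \<open>a * b\<close>, diag(N, 1) A equals the
      integral matrix with rows (\<alpha>, N \<beta>), (\<gamma> / N, \<delta>) times diag(N, 1). So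
      \<open>p = N\<close>, \<open>q = 0\<close>, \<open>r = 1\<close> is a valid decomposition and
      returns the original function.\<close>
    have *: "\<alpha> * \<delta> - (int N * \<beta>) * (\<gamma> div int N) = 1" "\<gamma> = \<gamma> div int N * int N" if "N dvd a * b" for N
    proof -
      have "int N dvd \<gamma>"
        using dvd that by (meson dvd_trans of_nat_dvd_iff)
      then show \<gamma>: "\<gamma> = \<gamma> div int N * int N"
        by simp
      have "(int N * \<beta>) * (\<gamma> div int N) = \<beta> * (\<gamma> div int N * int N)"
        by (simp only: mult_ac)
      then have "(int N * \<beta>) * (\<gamma> div int N) = \<beta> * \<gamma>"
        using \<gamma> by metis
      then show "\<alpha> * \<delta> - (int N * \<beta>) * (\<gamma> div int N) = 1"
        using det by (simp only:)
    qed
    have "eis_form k a b ((of_int \<alpha> * z + of_int \<beta>) / (of_int \<gamma> * z + of_int \<delta>)) / (of_int \<gamma> * z + of_int \<delta>) ^ (k + 4) =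
      rc_bracket k (- 1 / (4 * of_real pi * \<i> * of_nat a))
      (\<lambda>z. eis 2 ((of_int (int a) * z + of_int 0) / of_int 1) / of_int 1 ^ 2)
      (\<lambda>z. eis k ((of_int (int b) * z + of_int 0) / of_int 1) / of_int 1 ^ k) z"
      by (rule eis_form_slash[OF det k ab _ _ _ *(1)[of a] _ _ *(2)[of a] _ _ _ _ *(1)[of b] _ _ *(2)[of b] _ z])
        (use ab in auto)
    then show ?thesis
      using z by (simp add: eis_form_def slash_def e)
  qed
  have "mat 1 \<in> SL2Z"
    by (simp add: SL2Z_def)
  moreover have "slash (k + 4) (mat 1) (eis_form k a b) = eis_form k a b"
    by (simp add: slash_def mat_def fun_eq_iff)
  ultimately have "holomorphic_at_i_infinity (eis_form k a b)"
    using inf by metis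
  then have "eis_form k a b holomorphic_on upper_half_plane"
    by (rule holomorphic_at_i_infinity_imp_holomorphic)
  moreover have "eis_form k a b z = 0" if "z \<notin> upper_half_plane" for z
    using that by (simp add: eis_form_def)
  ultimately show ?thesis
    unfolding modular_forms_def using inf inv by simp
qed

section \<open>Fourier expansions\<close>

lemma modular_forms_periodic:
  assumes "f \<in> modular_forms k N" "Im z > 0"
  shows "f (z + 1) = f z"
proof -
  let ?T = "vector [vector [1, 1], vector [0, 1]] :: int ^ 2 ^ 2"
  have "?T \<in> Gamma0 N"
    by (simp add: Gamma0_def SL2Z_def det_2 vector_2)
  then have "slash k ?T f z = f z"
    using assms by (simp add: modular_forms_def)
  then show ?thesis
    by (simp add: slash_def vector_2)
qed

lemma nome_surj:
  assumes "0 < norm x" "norm x < 1"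
  obtains z where "Im z > 0" "nome z = x"
proof (rule that[of "Ln x / (2 * of_real pi * \<i>)"])
  have x: "x \<noteq> 0"
    using assms by auto
  then show n: "nome (Ln x / (2 * of_real pi * \<i>)) = x"
    by (simp add: nome_def)
  then have "exp (- 2 * pi * Im (Ln x / (2 * of_real pi * \<i>))) < 1"
    using norm_nome[of "Ln x / (2 * of_real pi * \<i>)"] assms by simp
  then show "Im (Ln x / (2 * of_real pi * \<i>)) > 0"
    by (simp add: zero_less_mult_iff pi_gt_zero not_less order.asym[OF pi_gt_zero] pi_ge_zero)
qed

text \<open>The nome covers the punctured unit disc; the missing value at 0 is supplied by
  continuity.\<close>

lemma eval_fps_nome_eqD:
  assumes "fps_conv_radius F \<ge> 1" "fps_conv_radius G \<ge> 1"
    and "\<And>z. Im z > 0 \<Longrightarrow> eval_fps F (nome z) = eval_fps G (nome z)"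
  shows "F = G"
proof (rule eval_fps_eqD)
  have pos: "fps_conv_radius F > 0" if "fps_conv_radius F \<ge> 1" for F :: "complex fps"
    using less_conv_radiusI[OF that, of 0] by (simp add: zero_ereal_def)
  show "fps_conv_radius F > 0" "fps_conv_radius G > 0"
    using pos assms by auto
  have cont: "isCont (eval_fps F) 0" if "fps_conv_radius F \<ge> 1" for F :: "complex fps"
    using pos[OF that] by (intro continuous_eval_fps) (simp add: zero_ereal_def)
  have ev: "\<forall>\<^sub>F x in at 0. eval_fps F x = eval_fps G x"
    unfolding eventually_at
  proof (intro exI[of _ 1] conjI ballI impI)
    fix x :: complex assume "x \<noteq> 0 \<and> dist x 0 < 1"
    then obtain z where "Im z > 0" "nome z = x"
      using nome_surj[of x] by auto
    then show "eval_fps F x = eval_fps G x"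
      using assms(3) by blast
  qed simp
  have "(eval_fps F \<longlongrightarrow> eval_fps F 0) (at 0)" "(eval_fps G \<longlongrightarrow> eval_fps G 0) (at 0)"
    using cont assms by (auto simp: isCont_def)
  moreover from this(2) have "(eval_fps F \<longlongrightarrow> eval_fps G 0) (at 0)"
    using ev by (simp add: tendsto_cong)
  ultimately have "eval_fps F 0 = eval_fps G 0"
    using LIM_unique by blast
  with ev show "\<forall>\<^sub>F x in nhds 0. eval_fps F x = eval_fps G x"
    by (auto simp: eventually_nhds_conv_at)
qed

lemma sums_eval_fps_nome:
  assumes "fps_conv_radius F \<ge> 1" "Im z > 0"
  shows "(\<lambda>n. fps_nth F n * nome z ^ n) sums eval_fps F (nome z)"
  by (intro sums_eval_fps in_eball_nome assms)

text \<open>Resolves the definite description: an expansion valid on the whole half plane converges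
  on the unit disc, since the nome is onto the punctured disc, and is therefore unique.\<close>

lemma fourier_coeff_eqI:
  assumes c: "\<And>z. Im z > 0 \<Longrightarrow> (\<lambda>n. c n * nome z ^ n) sums f z"
  shows "fourier_coeff f = c"
  unfolding fourier_coeff_def
proof (rule the_equality)
  show "\<forall>z\<in>upper_half_plane. (\<lambda>n. c n * exp (2 * complex_of_real pi * \<i> * z) ^ n) sums f z"
    using c by (simp add: nome_def)
  have rad: "fps_conv_radius (Abs_fps c) \<ge> 1" "eval_fps (Abs_fps c) (nome z) = f z"
    if c: "\<And>z. Im z > 0 \<Longrightarrow> (\<lambda>n. c n * nome z ^ n) sums f z" "Im z > 0" for c z
  proof -
    show "fps_conv_radius (Abs_fps c) \<ge> 1"
    proof (rule fps_conv_radius_ge_1I)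
      fix x :: complex assume x: "norm x < 1"
      show "summable (\<lambda>n. fps_nth (Abs_fps c) n * x ^ n)"
      proof (cases "x = 0")
        case True
        then show ?thesis
          using summable_finite[of "{0}" "\<lambda>n. fps_nth (Abs_fps c) n * x ^ n"] by simp
      next
        case False
        then obtain z where "Im z > 0" "nome z = x"
          using x nome_surj[of x] by auto
        then show ?thesis
          using c(1)[of z] by (auto simp: sums_iff)
      qed
    qed
    show "eval_fps (Abs_fps c) (nome z) = f z"
      using c(1)[OF c(2)] by (simp add: eval_fps_def sums_iff)
  qed
  fix c' assume "\<forall>z\<in>upper_half_plane. (\<lambda>n. c' n * exp (2 * complex_of_real pi * \<i> * z) ^ n) sums f z"
  then have c': "(\<lambda>n. c' n * nome z ^ n) sums f z" if "Im z > 0" for z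
    using that by (simp add: nome_def)
  have i: "Im \<i> > 0"
    by simp
  have "Abs_fps c' = Abs_fps c"
    by (rule eval_fps_nome_eqD[OF rad(1)[OF c' i] rad(1)[OF c i]]) (simp_all only: rad(2)[OF c'] rad(2)[OF c])
  then have "fps_nth (Abs_fps c') = fps_nth (Abs_fps c)"
    by simp
  then show "c' = c"
    by (simp add: fun_eq_iff)
qed

text \<open>The definition of a modular form only provides an expansion in exp(2 pi i z / m) for
  some \<open>m\<close>. Invariance under z + 1 forces the coefficients with index not divisible by
  \<open>m\<close> to vanish.\<close>

lemma modular_form_sums_fourier:
  assumes f: "f \<in> modular_forms k N" and z: "Im z > 0"
  shows "(\<lambda>n. fourier_coeff f n * nome z ^ n) sums f z"
proof -
  have "mat 1 \<in> SL2Z"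
    by (simp add: SL2Z_def)
  moreover have "slash k (mat 1) f = f"
    by (simp add: slash_def mat_def fun_eq_iff)
  ultimately have "holomorphic_at_i_infinity f"
    using f unfolding modular_forms_def by (metis (mono_tags, lifting) mem_Collect_eq)
  from holomorphic_at_i_infinityE[OF this] obtain m F where F: "m > 0" "F holomorphic_on ball 0 1"
    "\<And>z. Im z > 0 \<Longrightarrow> f z = F (exp (2 * of_real pi * \<i> * z / of_nat m))"
    by blast
  have F': "f z = F (nome (z / of_nat m))" if "Im z > 0" for z
    using F(3)[OF that] by (simp add: nome_def)
  define P where "P = fps_expansion F 0"
  have hol: "F holomorphic_on eball 0 1"
    using F(2) by (simp add: one_ereal_def)
  have P: "fps_conv_radius P \<ge> 1"
    unfolding P_def by (rule conv_radius_fps_expansion[OF hol])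
  have eP: "eval_fps P x = F x" if "norm x < 1" for x
    using eval_fps_expansion[OF hol, of x] that by (simp add: P_def one_ereal_def)
  \<comment> \<open>Translation of z by 1 multiplies the coordinate of width \<open>m\<close> by
    this primitive m-th root of unity; \<open>P'\<close> is the expansion after the
    translation.\<close>
  define u where "u = nome (1 / of_nat m)"
  have u: "norm u = 1"
    by (simp add: u_def norm_nome)
  define P' where "P' = Abs_fps (\<lambda>n. u ^ n * fps_nth P n)"
  have P'x: "(\<lambda>n. fps_nth P' n * x ^ n) sums eval_fps P (u * x)" if "norm x < 1" for x
  proof -
    have "norm (u * x) < 1"
      using that u by (simp add: norm_mult)
    from sums_eval_fps[OF less_conv_radiusI[OF P this]] show ?thesis
      by (simp add: P'_def power_mult_distrib mult_ac)
  qed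
  have P': "fps_conv_radius P' \<ge> 1"
    by (rule fps_conv_radius_ge_1I) (use P'x sums_summable in blast)
  have "P' = P"
  proof (rule eval_fps_nome_eqD[OF P' P])
    fix z :: complex assume z: "Im z > 0"
    have Im: "Im (of_nat m * z) > 0" "Im (of_nat m * z + 1) > 0"
      using z F(1) by simp_all
    have "eval_fps P' (nome z) = eval_fps P (u * nome z)"
      using P'x[OF norm_nome_less_1[OF z]] by (simp add: eval_fps_def sums_iff)
    also have "\<dots> = F (u * nome z)"
      using u norm_nome_less_1[OF z] by (intro eP) (simp add: norm_mult)
    also have "u * nome z = nome ((of_nat m * z + 1) / of_nat m)"
      using F(1) by (simp add: u_def nome_add add_divide_distrib mult.commute)
    also have "F \<dots> = f (of_nat m * z)"
      using F'[OF Im(2)] modular_forms_periodic[OF f Im(1)] by simp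
    also have "\<dots> = eval_fps P (nome z)"
      using F'[OF Im(1)] F(1) norm_nome_less_1[OF z] by (simp add: eP)
    finally show "eval_fps P' (nome z) = eval_fps P (nome z)" .
  qed
  have zero: "fps_nth P n = 0" if "\<not> m dvd n" for n
  proof -
    have "u ^ n * fps_nth P n = fps_nth P n"
      using arg_cong[OF \<open>P' = P\<close>, of "\<lambda>Q. fps_nth Q n"] by (simp add: P'_def)
    moreover have "u ^ n \<noteq> 1"
    proof
      assume "u ^ n = 1"
      then have "exp (2 * of_real pi * \<i> * (of_nat n / of_nat m)) = 1"
        by (simp add: u_def nome_def mult_ac flip: exp_of_nat_mult)
      then obtain c :: int where "2 * pi * (real n / real m) = real_of_int (2 * c) * pi"
        by (auto simp: exp_eq_1 Re_divide_of_nat Im_divide_of_nat)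
      then have "real n = real_of_int c * real m"
        using F(1) by (simp add: field_simps)
      then have "real_of_int (int n) = real_of_int (c * int m)"
        by simp
      then have "int n = c * int m"
        by (simp only: of_int_eq_iff)
      then show False
        using that by (metis dvd_triv_right of_nat_dvd_iff)
    qed
    ultimately show ?thesis
      by simp
  qed
  have sums: "(\<lambda>n. fps_nth P (m * n) * nome z ^ n) sums f z" if z: "Im z > 0" for z
  proof -
    let ?t = "nome (z / of_nat m)"
    have t: "norm ?t < 1"
      using z F(1) by (intro norm_nome_less_1) (simp add: Im_divide_of_nat)
    have "(\<lambda>n. fps_nth P n * ?t ^ n) sums f z"
      using sums_eval_fps[OF less_conv_radiusI[OF P t]] eP[OF t] F'[OF z] by simp
    moreover have "strict_mono (\<lambda>n. m * n)"
      using F(1) by (simp add: strict_mono_def)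
    ultimately have "(\<lambda>n. fps_nth P (m * n) * ?t ^ (m * n)) sums f z"
      by (subst sums_mono_reindex[where f = "\<lambda>n. fps_nth P n * ?t ^ n"]) (auto intro!: zero)
    moreover have "?t ^ m = nome z"
      using F(1) by (simp flip: nome_of_nat_mult)
    ultimately show ?thesis
      by (simp add: power_mult)
  qed
  then have "fourier_coeff f = (\<lambda>n. fps_nth P (m * n))"
    by (rule fourier_coeff_eqI)
  with sums[OF z] show ?thesis
    by simp
qed

section \<open>Dilated expansions and the coefficients of the bracket\<close>

definition fps_dilate :: "nat \<Rightarrow> complex fps \<Rightarrow> complex fps" where
  "fps_dilate a F = Abs_fps (\<lambda>n. if a dvd n then fps_nth F (n div a) else 0)"

lemma sums_fps_dilate:
  assumes "fps_conv_radius F \<ge> 1" "a > 0" "norm x < 1"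
  shows "(\<lambda>n. fps_nth (fps_dilate a F) n * x ^ n) sums eval_fps F (x ^ a)"
proof -
  have "norm (x ^ a) < 1"
    using assms by (simp add: norm_power power_less_one_iff)
  from sums_eval_fps[OF less_conv_radiusI[OF assms(1) this]]
  have "(\<lambda>n. fps_nth (fps_dilate a F) (a * n) * x ^ (a * n)) sums eval_fps F (x ^ a)"
    using assms by (simp add: fps_dilate_def power_mult)
  moreover have "strict_mono (\<lambda>n. a * n)"
    using assms by (simp add: strict_mono_def)
  ultimately show ?thesis
    by (subst (asm) sums_mono_reindex[where f = "\<lambda>n. fps_nth (fps_dilate a F) n * x ^ n"])
      (auto simp: fps_dilate_def)
qed

lemma conv_radius_fps_dilate:
  "fps_conv_radius F \<ge> 1 \<Longrightarrow> a > 0 \<Longrightarrow> fps_conv_radius (fps_dilate a F) \<ge> 1"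
  by (rule fps_conv_radius_ge_1I) (use sums_fps_dilate sums_summable in blast)

lemma eval_fps_dilate_nome:
  assumes "fps_conv_radius F \<ge> 1" "a > 0" "Im z > 0"
  shows "eval_fps F (nome (of_nat a * z)) = eval_fps (fps_dilate a F) (nome z)"
  using sums_fps_dilate[OF assms(1,2) norm_nome_less_1[OF assms(3)]]
  by (simp add: eval_fps_def[of "fps_dilate a F"] nome_of_nat_mult sums_iff)

lemma rc_bracket_eval_fps:
  fixes k :: nat and s :: complex
  assumes F: "fps_conv_radius F \<ge> 1" and G: "fps_conv_radius G \<ge> 1"
    and f: "\<And>z. Im z > 0 \<Longrightarrow> f z = eval_fps F (nome z)"
    and g: "\<And>z. Im z > 0 \<Longrightarrow> g z = eval_fps G (nome z)"
    and z: "Im z > 0"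
  defines "H \<equiv> fps_const (of_nat k) * (nome_deriv F * G) - fps_const 2 * (F * nome_deriv G)
      + fps_const (s / of_nat (k + 1)) * nome_deriv (nome_deriv G)"
  shows "(\<lambda>n. fps_nth H n * nome z ^ n) sums rc_bracket k s f g z"
proof -
  have d: "deriv h z = eval_fps (nome_deriv H) (nome z)"
    if "\<And>z. Im z > 0 \<Longrightarrow> h z = eval_fps H (nome z)" "fps_conv_radius H \<ge> 1" "Im z > 0" for h H z
    using deriv_cong_upper_half_plane[OF that(1,3)]
      DERIV_imp_deriv[OF has_field_derivative_eval_fps_nome[OF that(2,3)]] by simp
  have d1: "deriv f z = eval_fps (nome_deriv F) (nome z)"
    by (rule d[OF f F z])
  have d2: "deriv g z = eval_fps (nome_deriv G) (nome z)" if "Im z > 0" for z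
    by (rule d[OF g G that])
  have d3: "deriv (deriv g) z = eval_fps (nome_deriv (nome_deriv G)) (nome z)"
    by (rule d[OF d2 conv_radius_nome_deriv[OF G] z])
  have prod: "(\<lambda>n. fps_nth (A * B) n * nome z ^ n) sums (eval_fps A (nome z) * eval_fps B (nome z))"
    if "fps_conv_radius A \<ge> 1" "fps_conv_radius B \<ge> 1" for A B
    using sums_eval_fps_nome[OF conv_radius_mult_ge[OF that] z]
    by (simp add: eval_fps_mult in_eball_nome that z)
  have "(\<lambda>n. of_nat k * (fps_nth (nome_deriv F * G) n * nome z ^ n) - 2 * (fps_nth (F * nome_deriv G) n * nome z ^ n)
      + s / of_nat (k + 1) * (fps_nth (nome_deriv (nome_deriv G)) n * nome z ^ n)) sums
    (of_nat k * (eval_fps (nome_deriv F) (nome z) * eval_fps G (nome z)) -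
      2 * (eval_fps F (nome z) * eval_fps (nome_deriv G) (nome z)) +
      s / of_nat (k + 1) * eval_fps (nome_deriv (nome_deriv G)) (nome z))"
    by (intro sums_add sums_diff sums_mult prod sums_eval_fps_nome conv_radius_nome_deriv F G z)
  then show ?thesis
    by (simp only: H_def rc_bracket_def d1 d2[OF z] d3 f[OF z] g[OF z] fps_add_nth fps_sub_nth
        fps_mult_left_const_nth left_diff_distrib distrib_right mult.assoc)
qed

lemma divisor_sigma_divide:
  assumes "a > 0"
  shows "divisor_sigma r (real n / real a) = (if a dvd n then divisor_sigma r (real (n div a)) else 0)"
proof (cases "a dvd n")
  case True
  then show ?thesis
    using assms by (auto elim!: dvdE)
next
  case False
  have "real n / real a \<notin> \<nat>"
  proof
    assume "real n / real a \<in> \<nat>"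
    then obtain j where "real n / real a = real j"
      by (auto elim: Nats_cases)
    then have "real n = real (j * a)"
      using assms by (simp add: field_simps)
    then show False
      using False by (simp only: of_nat_eq_iff) simp
  qed
  then show ?thesis
    using False by (simp add: divisor_sigma_def)
qed

lemma divisor_sigma_divide_nonzeroD:
  assumes "divisor_sigma r (real n / real a) \<noteq> 0" "a > 0"
  shows "a dvd n" "n > 0"
proof -
  show "a dvd n"
    using assms by (metis divisor_sigma_divide)
  show "n > 0"
    using assms by (cases n) (auto simp: divisor_sigma_def)
qed

text \<open>Substitute \<open>i = a l\<close>, \<open>n - i = b m\<close>; any other
  \<open>i\<close> contributes 0 by the convention for \<open>divisor_sigma\<close> off the positive
  integers. The weight \<open>p\<close> allows one lemma to give both the sum with the factor
  \<open>l\<close> and \<open>W\<close>.\<close>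

lemma sum_conv_pairs:
  fixes p :: "nat \<Rightarrow> complex"
  assumes "a > 0" "b > 0"
  shows "(\<Sum>i=0..n. p i * of_nat (divisor_sigma r (real i / real a)) * of_nat (divisor_sigma s (real (n - i) / real b)))
    = (\<Sum>(l, m) \<in> conv_pairs a b n. p (a * l) * of_nat (divisor_sigma r (real l)) * of_nat (divisor_sigma s (real m)))"
proof -
  let ?g = "\<lambda>i. p i * of_nat (divisor_sigma r (real i / real a)) * of_nat (divisor_sigma s (real (n - i) / real b))"
  let ?P = "conv_pairs a b n"
  have mem: "l > 0" "m > 0" "a * l + b * m = n" if "(l, m) \<in> ?P" for l m
    using that by (auto simp: conv_pairs_def)
  have "(\<Sum>(l, m) \<in> ?P. p (a * l) * of_nat (divisor_sigma r (real l)) * of_nat (divisor_sigma s (real m)))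
    = (\<Sum>x \<in> ?P. ?g (a * fst x))"
  proof (intro sum.cong refl, clarify)
    fix l m assume P: "(l, m) \<in> ?P"
    have "n - a * l = b * m"
      using mem[OF P] by simp
    then show "p (a * l) * of_nat (divisor_sigma r (real l)) * of_nat (divisor_sigma s (real m)) = ?g (a * fst (l, m))"
      using assms by simp
  qed
  also have "\<dots> = sum ?g ((\<lambda>x. a * fst x) ` ?P)"
  proof (subst sum.reindex)
    show "inj_on (\<lambda>x. a * fst x) ?P"
      using assms by (auto simp: inj_on_def conv_pairs_def)
  qed (simp add: o_def)
  also have "\<dots> = sum ?g {0..n}"
  proof (rule sum.mono_neutral_left)
    show "(\<lambda>x. a * fst x) ` ?P \<subseteq> {0..n}"
      by (auto simp: conv_pairs_def)
    show "\<forall>i\<in>{0..n} - (\<lambda>x. a * fst x) ` ?P. ?g i = 0"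
    proof
      fix i assume i: "i \<in> {0..n} - (\<lambda>x. a * fst x) ` ?P"
      have "divisor_sigma r (real i / real a) = 0 \<or> divisor_sigma s (real (n - i) / real b) = 0"
      proof (rule ccontr)
        assume "\<not> ?thesis"
        then have "a dvd i" "b dvd n - i" "i > 0" "n - i > 0"
          using assms divisor_sigma_divide_nonzeroD by blast+
        moreover from this obtain l m where "i = a * l" "n - i = b * m"
          by (meson dvdE)
        ultimately have "(l, m) \<in> ?P"
          using i by (auto simp: conv_pairs_def intro!: Nat.gr0I)
        then have "i \<in> (\<lambda>x. a * fst x) ` ?P"
          using \<open>i = a * l\<close> by force
        then show False
          using i by blast
      qed
      then show "?g i = 0"
        by auto
    qed
  qed simp
  finally show ?thesis ..
qed

lemma divisor_sigma_0: "divisor_sigma r 0 = 0"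
  by (simp add: divisor_sigma_def)

lemma sum_fun_apply: "(\<Sum>i\<in>I. f i) z = (\<Sum>i\<in>I. f i z)"
  for f :: "'i \<Rightarrow> 'a \<Rightarrow> 'b::comm_monoid_add"
  by (induction I rule: infinite_finite_induct) auto

lemma fourier_coeff_eis_form:
  assumes k: "even k" "k \<ge> 4" and ab: "a > 0" "b > 0" and n: "n > 0"
  defines "X \<equiv> \<Sum>(l, m) \<in> conv_pairs a b n.
      of_nat l * of_nat (divisor_sigma 1 (real l)) * of_nat (divisor_sigma (k - 1) (real m)) :: complex"
    and "S \<equiv> of_nat (divisor_sigma 1 (real n / real a))"
    and "T \<equiv> of_nat (divisor_sigma (k - 1) (real n / real b))"
    and "W \<equiv> of_nat (conv_sum 1 (k - 1) a b n)"
  shows "fourier_coeff (eis_form k a b) n = 2 * of_real pi * \<i> *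
    (of_nat a * (of_nat k + 2) * X - of_nat n * S * of_real (bernoulli_number k) / 2 - 2 * of_nat n * W
      + of_nat n * T / 12 - of_nat n ^ 2 * T / (2 * of_nat a * (of_nat k + 1)))"
proof -
  define A where "A = fps_dilate a (eis_fps 2 (- of_real (bernoulli_number 2) / (2 * of_nat 2)))"
  define \<beta> where "\<beta> = - of_real (bernoulli_number k) / (2 * of_nat k :: complex)"
  define B where "B = fps_dilate b (eis_fps k \<beta>)"
  define s where "s = - 1 / (4 * of_real pi * \<i> * of_nat a :: complex)"
  define c where "c = (2 * of_real pi * \<i> :: complex)"
  define H where "H = fps_const (of_nat k) * (nome_deriv A * B) - fps_const 2 * (A * nome_deriv B)
      + fps_const (s / of_nat (k + 1)) * nome_deriv (nome_deriv B)"
  let ?S = "\<lambda>i. of_nat (divisor_sigma 1 (real i / real a)) :: complex"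
  let ?T = "\<lambda>i. of_nat (divisor_sigma (k - 1) (real i / real b)) :: complex"
  have rad: "fps_conv_radius A \<ge> 1" "fps_conv_radius B \<ge> 1"
    unfolding A_def B_def using k ab by (auto intro!: conv_radius_fps_dilate conv_radius_eis_fps)
  have "(\<lambda>n. fps_nth H n * nome z ^ n) sums eis_form k a b z" if z: "Im z > 0" for z
  proof -
    have "(\<lambda>n. fps_nth H n * nome z ^ n) sums rc_bracket k s (\<lambda>z. eis 2 (of_nat a * z)) (\<lambda>z. eis k (of_nat b * z)) z"
      unfolding H_def
    proof (rule rc_bracket_eval_fps[OF rad _ _ z])
      show "eis 2 (of_nat a * z) = eval_fps A (nome z)" "eis k (of_nat b * z) = eval_fps B (nome z)" if "Im z > 0" for z
        unfolding eis_def A_def B_def \<beta>_def using k ab that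
        by (auto intro!: eval_fps_dilate_nome conv_radius_eis_fps)
    qed
    then show ?thesis
      using z by (simp add: eis_form_def s_def)
  qed
  then have "fourier_coeff (eis_form k a b) n = fps_nth H n"
    by (subst fourier_coeff_eqI) auto
  also have "fps_nth H n = of_nat k * (\<Sum>i=0..n. c * of_nat i * A $ i * B $ (n - i))
      - 2 * (\<Sum>i=0..n. A $ i * (c * of_nat (n - i) * B $ (n - i)))
      + s / of_nat (k + 1) * (c * of_nat n * (c * of_nat n * B $ n))"
    unfolding H_def fps_add_nth fps_sub_nth fps_mult_left_const_nth
    by (simp only: nome_deriv_nth fps_mult_nth c_def)
  \<comment> \<open>The derivative removes the constant term of \<open>A\<close>, so only the
    constant term \<beta> of \<open>B\<close> adds something, at \<open>i = n\<close>.\<close>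
  also have "(\<Sum>i=0..n. c * of_nat i * A $ i * B $ (n - i)) = c * (of_nat a * X + of_nat n * S * \<beta>)"
  proof -
    have A: "A $ i = (if i = 0 then - 1 / 24 else 0) + ?S i" and B: "B $ i = (if i = 0 then \<beta> else 0) + ?T i" for i
      using ab by (auto simp: A_def B_def fps_dilate_def eis_fps_def divisor_sigma_divide bernoulli_number_2 divisor_sigma_0)
    have "(\<Sum>i=0..n. c * of_nat i * A $ i * B $ (n - i)) =
        (\<Sum>i=0..n. c * (of_nat i * ?S i * ?T (n - i)) + (if i = n then c * (of_nat n * S * \<beta>) else 0))"
      unfolding A B by (intro sum.cong refl) (auto simp: S_def algebra_simps)
    also have "\<dots> = c * (\<Sum>i=0..n. of_nat i * ?S i * ?T (n - i)) + c * (of_nat n * S * \<beta>)"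
      by (simp add: sum.distrib sum_distrib_left)
    also have "(\<Sum>i=0..n. of_nat i * ?S i * ?T (n - i)) = of_nat a * X"
      using sum_conv_pairs[OF ab, of of_nat] by (simp add: X_def sum_distrib_left case_prod_unfold mult.assoc)
    finally show ?thesis
      by (simp add: algebra_simps)
  qed
  \<comment> \<open>Now only the constant term -1/24 of \<open>A\<close> survives, at
    \<open>i = 0\<close>. Splitting the weight as \<open>n - i\<close> expresses the rest through
    \<open>W\<close> and \<open>X\<close>.\<close>
  also have "(\<Sum>i=0..n. A $ i * (c * of_nat (n - i) * B $ (n - i))) = c * (of_nat n * W - of_nat a * X - of_nat n * T / 24)"
  proof -
    have A: "A $ i = (if i = 0 then - 1 / 24 else 0) + ?S i" and B: "of_nat i * B $ i = of_nat i * ?T i" for i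
      using ab by (auto simp: A_def B_def fps_dilate_def eis_fps_def divisor_sigma_divide bernoulli_number_2 divisor_sigma_0)
    have "(\<Sum>i=0..n. A $ i * (c * of_nat (n - i) * B $ (n - i))) =
        (\<Sum>i=0..n. A $ i * (c * (of_nat (n - i) * ?T (n - i))))"
      by (simp only: mult.assoc B)
    also have "\<dots> = (\<Sum>i=0..n. c * (of_nat (n - i) * ?S i * ?T (n - i)) + (if i = 0 then c * (- (of_nat n * T / 24)) else 0))"
      unfolding A by (intro sum.cong refl) (auto simp: T_def algebra_simps)
    also have "\<dots> = c * (\<Sum>i=0..n. of_nat (n - i) * ?S i * ?T (n - i)) + c * (- (of_nat n * T / 24))"
      by (simp add: sum.distrib sum_distrib_left)
    also have "(\<Sum>i=0..n. of_nat (n - i) * ?S i * ?T (n - i)) =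
        of_nat n * (\<Sum>i=0..n. 1 * ?S i * ?T (n - i)) - (\<Sum>i=0..n. of_nat i * ?S i * ?T (n - i))"
      unfolding sum_distrib_left sum_subtractf[symmetric]
      by (intro sum.cong refl) (auto simp: of_nat_diff algebra_simps)
    also have "(\<Sum>i=0..n. of_nat i * ?S i * ?T (n - i)) = of_nat a * X"
      using sum_conv_pairs[OF ab, of of_nat] by (simp add: X_def sum_distrib_left case_prod_unfold mult.assoc)
    also have "(\<Sum>i=0..n. 1 * ?S i * ?T (n - i)) = W"
      using sum_conv_pairs[OF ab, of "\<lambda>_. 1"] by (simp add: W_def conv_sum_def case_prod_unfold)
    finally show ?thesis
      by (simp add: algebra_simps)
  qed
  also have "B $ n = T"
    using ab n by (auto simp: B_def T_def fps_dilate_def eis_fps_def divisor_sigma_divide)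
  \<comment> \<open>The sum \<open>X\<close> occurs \<open>k\<close> times in the first product and
    twice in the second, which gives the factor \<open>k + 2\<close>.\<close>
  also have "of_nat k * (c * (of_nat a * X + of_nat n * S * \<beta>)) -
      2 * (c * (of_nat n * W - of_nat a * X - of_nat n * T / 24)) +
      s / of_nat (k + 1) * (c * of_nat n * (c * of_nat n * T)) =
    c * (of_nat a * (of_nat k + 2) * X + of_nat n * S * (of_nat k * \<beta>) - 2 * of_nat n * W
      + of_nat n * T / 12 + (s * c) * (of_nat n ^ 2 * T / (of_nat k + 1)))"
    by (simp add: algebra_simps power2_eq_square)
  also have "of_nat k * \<beta> = - of_real (bernoulli_number k) / 2"
    using k by (simp add: \<beta>_def)
  also have "s * c = - 1 / (2 * of_nat a)"
    using ab by (simp add: s_def c_def field_simps)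
  finally show ?thesis
    unfolding c_def by (simp add: algebra_simps)
qed

theorem theorem3p4:
  fixes k a b :: nat
    and h :: "nat \<Rightarrow> complex \<Rightarrow> complex"
  assumes "even k" and "k \<ge> 4"
    and "a > 0" and "b > 0" and "gcd a b = 1"
    and "indexed_basis {1..cfun.dim (modular_forms (k + 4) (a * b))} h (modular_forms (k + 4) (a * b))"
  shows "\<exists>\<gamma> :: nat \<Rightarrow> complex. \<forall>n::nat. n \<ge> 2 \<longrightarrow>
    (\<Sum>(l, m) \<in> conv_pairs a b n.
        of_nat l * of_nat (divisor_sigma 1 (real l)) * of_nat (divisor_sigma (k - 1) (real m))) =
      (6 * of_nat n ^ 2 - of_nat a * (of_nat k + 1) * of_nat n)
          / (12 * of_nat a ^ 2 * (of_nat k + 1) * (of_nat k + 2))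
        * of_nat (divisor_sigma (k - 1) (real n / real b))
      + of_real (bernoulli_number k) / (2 * of_nat a * (of_nat k + 2))
        * of_nat n * of_nat (divisor_sigma 1 (real n / real a))
      + 2 * of_nat n / (of_nat a * (of_nat k + 2)) * of_nat (conv_sum 1 (k - 1) a b n)
      + of_real (bernoulli_number k) / (4 * of_nat a ^ 2 * of_nat k * (of_nat k + 1) * (of_nat k + 2))
        * (\<Sum>i = 1..cfun.dim (modular_forms (k + 4) (a * b)). \<gamma> i * fourier_coeff (h i) n)"
proof -
  define M where "M = modular_forms (k + 4) (a * b)"
  define I where "I = {1..cfun.dim M}"
  define F where "F = eis_form k a b"
  \<comment> \<open>\<kappa> is the prefactor of the \<gamma>_i in the claim and \<open>c\<close>
    the factor of the wanted sum in the coefficient of \<open>F\<close>. The witnesses are the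
    coordinates of \<open>F\<close> divided by \<kappa> \<open>c\<close>.\<close>
  define \<kappa> where "\<kappa> = of_real (bernoulli_number k) / (4 * of_nat a ^ 2 * of_nat k * (of_nat k + 1) * (of_nat k + 2) :: complex)"
  define c where "c = (2 * of_real pi * \<i> * of_nat a * (of_nat k + 2) :: complex)"
  have nz: "of_nat k + 1 \<noteq> (0 :: complex)" "of_nat k + 2 \<noteq> (0 :: complex)" "of_nat a \<noteq> (0 :: complex)"
    using of_nat_neq_0[of k, where 'a = complex] of_nat_neq_0[of "Suc k", where 'a = complex] assms(3)
    by (simp_all add: add.commute)
  have \<kappa>: "\<kappa> \<noteq> 0"
    using nz assms bernoulli_number_nonzero[of k] by (auto simp: \<kappa>_def)
  have inj: "inj_on h I" and span: "cfun.span (h ` I) = M"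
    using assms(6) by (auto simp: indexed_basis_def M_def I_def)
  have hM: "h i \<in> M" if "i \<in> I" for i
    using that span cfun.span_base[of "h i" "h ` I"] by auto
  have "F \<in> M"
    unfolding F_def M_def by (rule eis_form_modular) (use assms in auto)
  \<comment> \<open>The index set is finite, so the span consists of combinations over all basis
    vectors; injectivity of \<open>h\<close> then turns them into sums over indices.\<close>
  then have "F \<in> range (\<lambda>u. \<Sum>v\<in>h ` I. (\<lambda>z. u v * v z))"
    using span cfun.span_finite[of "h ` I"] by (simp add: I_def)
  then obtain u where "F = (\<Sum>v\<in>h ` I. (\<lambda>z. u v * v z))"
    by blast
  also have "\<dots> = (\<Sum>i\<in>I. (\<lambda>z. u (h i) * h i z))"
    by (simp add: sum.reindex[OF inj])
  finally have F: "F z = (\<Sum>i\<in>I. u (h i) * h i z)" for z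
    by (simp add: sum_fun_apply)
  have "fourier_coeff F = (\<lambda>n. \<Sum>i\<in>I. u (h i) * fourier_coeff (h i) n)"
  proof (rule fourier_coeff_eqI)
    fix z :: complex assume z: "Im z > 0"
    have "(\<lambda>n. \<Sum>i\<in>I. u (h i) * (fourier_coeff (h i) n * nome z ^ n)) sums (\<Sum>i\<in>I. u (h i) * h i z)"
      by (intro sums_sum sums_mult modular_form_sums_fourier[OF hM[unfolded M_def] z])
    then show "(\<lambda>n. (\<Sum>i\<in>I. u (h i) * fourier_coeff (h i) n) * nome z ^ n) sums F z"
      by (simp add: F sum_distrib_right mult.assoc)
  qed
  then have coeff: "(\<Sum>i\<in>I. u (h i) / (\<kappa> * c) * fourier_coeff (h i) n) = fourier_coeff F n / (\<kappa> * c)" for n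
    by (simp add: sum_divide_distrib)
  show ?thesis
    unfolding M_def[symmetric] I_def[symmetric] \<kappa>_def[symmetric]
  proof (intro exI[of _ "\<lambda>i. u (h i) / (\<kappa> * c)"] allI impI)
    fix n :: nat assume "n \<ge> 2"
    define X S T W where
      "X = (\<Sum>(l, m) \<in> conv_pairs a b n.
        of_nat l * of_nat (divisor_sigma 1 (real l)) * of_nat (divisor_sigma (k - 1) (real m)) :: complex)"
      and "S = (of_nat (divisor_sigma 1 (real n / real a)) :: complex)"
      and "T = (of_nat (divisor_sigma (k - 1) (real n / real b)) :: complex)"
      and "W = (of_nat (conv_sum 1 (k - 1) a b n) :: complex)"
    note defs = X_def[symmetric] S_def[symmetric] T_def[symmetric] W_def[symmetric]
    define K A N :: complex and \<beta> where "K = of_nat k" and "A = of_nat a" and "N = of_nat n"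
      and "\<beta> = complex_of_real (bernoulli_number k)"
    have \<phi>: "fourier_coeff F n = 2 * of_real pi * \<i> *
      (A * (K + 2) * X - N * S * \<beta> / 2 - 2 * N * W + N * T / 12 - N ^ 2 * T / (2 * A * (K + 1)))"
      using fourier_coeff_eis_form[OF assms(1-4), of n] \<open>n \<ge> 2\<close>
      unfolding defs F_def K_def A_def N_def \<beta>_def by simp
    have KA: "K + 1 \<noteq> 0" "K + 2 \<noteq> 0" "A \<noteq> 0"
      using nz by (simp_all add: K_def A_def)
    have c0: "c = 2 * of_real pi * \<i> * (A * (K + 2))" "2 * of_real pi * \<i> \<noteq> (0 :: complex)"
      by (simp_all add: c_def A_def K_def)
    have "\<kappa> * (fourier_coeff F n / (\<kappa> * c)) = fourier_coeff F n / c"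
      using \<kappa> by simp
    also have "\<dots> = (A * (K + 2) * X - N * S * \<beta> / 2 - 2 * N * W + N * T / 12 - N ^ 2 * T / (2 * A * (K + 1))) / (A * (K + 2))"
      unfolding \<phi> c0(1) using c0(2) by (rule mult_divide_mult_cancel_left)
    also have "\<dots> = X - ((6 * N ^ 2 - A * (K + 1) * N) / (12 * A ^ 2 * (K + 1) * (K + 2)) * T
        + \<beta> / (2 * A * (K + 2)) * N * S + 2 * N / (A * (K + 2)) * W)"
      using KA by (simp add: divide_simps power2_eq_square) (simp add: algebra_simps)
    finally show "(\<Sum>(l, m) \<in> conv_pairs a b n.
        of_nat l * of_nat (divisor_sigma 1 (real l)) * of_nat (divisor_sigma (k - 1) (real m))) =
      (6 * of_nat n ^ 2 - of_nat a * (of_nat k + 1) * of_nat n)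
          / (12 * of_nat a ^ 2 * (of_nat k + 1) * (of_nat k + 2))
        * of_nat (divisor_sigma (k - 1) (real n / real b))
      + of_real (bernoulli_number k) / (2 * of_nat a * (of_nat k + 2))
        * of_nat n * of_nat (divisor_sigma 1 (real n / real a))
      + 2 * of_nat n / (of_nat a * (of_nat k + 2)) * of_nat (conv_sum 1 (k - 1) a b n)
      + \<kappa> * (\<Sum>i \<in> I. u (h i) / (\<kappa> * c) * fourier_coeff (h i) n)"
      unfolding coeff defs K_def[symmetric] A_def[symmetric] N_def[symmetric] \<beta>_def[symmetric] by simp
  qed
qed

end
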